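(* Let $\kappa>0$ and let $\rho:\mathbb{R}\to\mathbb{R}$ be Lipschitz continuous with $\rho^2(x)=\lambda^2(\varsigma^2+x^2)$ for all $x\in\mathbb{R}$, where $\lambda\ne0$ and $\varsigma\ge0$. Let $g(x)\equiv w$ and $\mu(dx)=\widetilde w\,dx$ with $w,\widetilde w\in\mathbb{R}$, and let $u$ be the solution of $u(t,x)=J_0(t,x)+\iint_{[0,t]\times\mathbb{R}}G_\kappa(t-s,x-y)\rho(u(s,y))W(ds,dy)$ with these initial data. Let $\mathcal H(t)=\cosh(|\lambda|\sqrt{\kappa/2}\,t)-1$. Then: (1) For all $t\ge0$ and $x\in\mathbb{R}$, $$\|u(t,x)\|_2^2=w^2+\Big(w^2+\varsigma^2+\frac{4\kappa\widetilde w^2}{\lambda^2}\Big)\mathcal H(t)+\frac{2\sqrt{2\kappa}\,w\widetilde w}{|\lambda|}\sinh\Big(\frac{\sqrt\kappa|\lambda|t}{\sqrt2}\Big).$$ In particular, $\|u(t,x)\|_2^2=w^2(\mathcal H(t)+1)$ if $\varsigma=\widetilde w=0$, and $\|u(t,x)\|_2^2=\frac{4\kappa\widetilde w^2}{\lambda^2}\mathcal H(t)$ if $\varsigma=w=0$. (2) For all $t\ge0$ and $x,y\in\mathbb{R}$, with $T=T_\kappa(t,x-y)$, $$E[u(t,x)u(t,y)]=w^2+\kappa\widetilde w(t-T)\big(2w+\kappa\widetilde w(t+T)\big)+\Big(w^2+\varsigma^2+\frac{4\kappa\widetilde w^2}{\lambda^2}\Big)\mathcal H(T)+\frac{2\sqrt{2\kappa}\,w\widetilde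 w}{|\lambda|}\sinh\Big(\frac{\sqrt\kappa|\lambda|}{\sqrt2}T\Big).$$ In particular, $E[u(t,x)u(t,y)]=w^2(\mathcal H(T)+1)$ if $\varsigma=\widetilde w=0$, and $E[u(t,x)u(t,y)]=\frac{4\kappa\widetilde w^2}{\lambda^2}\mathcal H(T)+\kappa^2\widetilde w^2(t^2-T^2)$ if $\varsigma=w=0$.
   Context: $W$ is a space-time white noise on $\mathbb{R}_+\times\mathbb{R}$ (with $\mathbb{R}_+=[0,\infty)$), $(\mathcal F_t)$ its natural augmented filtration, stochastic integrals are in the sense of Walsh, $\|\cdot\|_2$ is the $L^2(\Omega)$-norm. $G_\kappa(t,x)=\frac12 1_{\{t\ge0\}}1_{[-\kappa t,\kappa t]}(x)$ and $J_0(t,x)=\frac12(g(x+\kappa t)+g(x-\kappa t))+\int_{\mathbb{R}}G_\kappa(t,x-y)\mu(dy)$. A solution is an adapted, jointly measurable random field $u=J_0+I$ satisfying the integral equation, with $I$ the stochastic integral, such that $\int_0^t\int_{\mathbb{R}} G_\kappa^2(t-s,x-y)\|\rho(u(s,y))\|_2^2\,dy\,ds<\infty$ for all $t>0,x\in\mathbb{R}$ and $(t,x)\mapsto I(t,x)$ is continuous from $\mathbb{R}_+\times\mathbb{R}$ into $L^2(\Omega)$; such a solution exists and is unique up to versions. $T_\kappa(t,x)=\big(t-\frac{|x|}{2\kappa}\big)1_{\{|x|\le2\kappa t\}}$. *)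

theory Defs
  imports "HOL-Probability.Probability"
begin

definition L2_norm_sq :: "'a measure \<Rightarrow> ('a \<Rightarrow> real) \<Rightarrow> ennreal" where
  "L2_norm_sq M X = (\<integral>\<^sup>+ \<omega>. ennreal ((X \<omega>)\<^sup>2) \<partial>M)"

definition noise_sets :: "(real \<times> real) set set" where
  "noise_sets = {A \<in> sets borel. A \<subseteq> {0..} \<times> UNIV \<and> emeasure lborel A < \<infinity>}"

text \<open>Space-time white noise in the sense of Walsh: a centred Gaussian, independently scattered,
  additive random set function whose variance is the Lebesgue measure. The normal law with
  variance zero is the Dirac mass at zero, which \<^const>\<open>normal_density\<close> does not cover.\<close>

locale space_time_white_noise = prob_space M
  for M :: "'a measure" and W :: "(real \<times> real) set \<Rightarrow> 'a \<Rightarrow> real" +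
  assumes noise_measurable: "A \<in> noise_sets \<Longrightarrow> W A \<in> borel_measurable M"
    and noise_gaussian:
      "A \<in> noise_sets \<Longrightarrow> measure lborel A > 0 \<Longrightarrow>
        distributed M lborel (W A) (\<lambda>x. ennreal (normal_density 0 (sqrt (measure lborel A)) x))"
    and noise_null: "A \<in> noise_sets \<Longrightarrow> measure lborel A = 0 \<Longrightarrow> AE \<omega> in M. W A \<omega> = 0"
    and noise_indep:
      "finite \<A> \<Longrightarrow> \<A> \<subseteq> noise_sets \<Longrightarrow> disjoint \<A> \<Longrightarrow> indep_vars (\<lambda>_. borel) W \<A>"
    and noise_additive:
      "finite \<A> \<Longrightarrow> \<A> \<subseteq> noise_sets \<Longrightarrow> disjoint \<A> \<Longrightarrow>
        AE \<omega> in M. W (\<Union>\<A>) \<omega> = (\<Sum>A\<in>\<A>. W A \<omega>)"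

text \<open>The martingale measure associated with the noise, and its filtration augmented by the
  null sets.\<close>

definition noise_upto :: "((real \<times> real) set \<Rightarrow> 'a \<Rightarrow> real) \<Rightarrow> real \<Rightarrow> real set \<Rightarrow> 'a \<Rightarrow> real" where
  "noise_upto W t B = W ({0..t} \<times> B)"

definition noise_filtration ::
    "'a measure \<Rightarrow> ((real \<times> real) set \<Rightarrow> 'a \<Rightarrow> real) \<Rightarrow> real \<Rightarrow> 'a measure" where
  "noise_filtration M W t = sigma (space M)
     ({noise_upto W s B -` C \<inter> space M | s B C.
         0 \<le> s \<and> s \<le> t \<and> B \<in> sets borel \<and> emeasure lborel B < \<infinity> \<and> C \<in> sets borel}
      \<union> null_sets M)"

text \<open>The entry \<open>(\<xi>, a, b, B)\<close> stands for the elementary process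
  \<open>\<xi>(\<omega>) 1\<^bsub>(a,b]\<^esub>(s) 1\<^bsub>B\<^esub>(y)\<close>; a simple process is the sum of a list of these.\<close>

type_synonym 'a simple_proc = "(('a \<Rightarrow> real) \<times> real \<times> real \<times> real set) list"

definition simple_process ::
    "'a measure \<Rightarrow> ((real \<times> real) set \<Rightarrow> 'a \<Rightarrow> real) \<Rightarrow> 'a simple_proc \<Rightarrow> bool" where
  "simple_process M W S \<longleftrightarrow>
     (\<forall>(\<xi>, a, b, B) \<in> set S. 0 \<le> a \<and> a \<le> b \<and> B \<in> sets borel \<and> emeasure lborel B < \<infinity> \<and>
        \<xi> \<in> borel_measurable (noise_filtration M W a) \<and> (\<exists>K. \<forall>\<omega>\<in>space M. \<bar>\<xi> \<omega>\<bar> \<le> K))"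

definition simple_value :: "'a simple_proc \<Rightarrow> real \<Rightarrow> real \<Rightarrow> 'a \<Rightarrow> real" where
  "simple_value S s y \<omega> =
     (\<Sum>(\<xi>, a, b, B) \<leftarrow> S. \<xi> \<omega> * indicator {a<..b} s * indicator B y)"

definition simple_walsh_integral ::
    "((real \<times> real) set \<Rightarrow> 'a \<Rightarrow> real) \<Rightarrow> real \<Rightarrow> 'a simple_proc \<Rightarrow> 'a \<Rightarrow> real" where
  "simple_walsh_integral W t S \<omega> =
     (\<Sum>(\<xi>, a, b, B) \<leftarrow> S. \<xi> \<omega> * (noise_upto W (min t b) B \<omega> - noise_upto W (min t a) B \<omega>))"

definition slab :: "real \<Rightarrow> (real \<times> real) measure" where
  "slab t = restrict_space lborel ({0..t} \<times> UNIV)"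

text \<open>\<open>has_walsh_integral M W t X Y\<close>: the random variable \<open>Y\<close> is (a version of) the Walsh integral of
  the random field \<open>X\<close> over \<open>[0,t] \<times> \<real>\<close>, obtained by extending the integral of simple
  processes by continuity with respect to the norm of \<open>L\<^sup>2([0,t] \<times> \<real> \<times> \<Omega>)\<close>.\<close>

definition has_walsh_integral ::
    "'a measure \<Rightarrow> ((real \<times> real) set \<Rightarrow> 'a \<Rightarrow> real) \<Rightarrow> real \<Rightarrow> (real \<Rightarrow> real \<Rightarrow> 'a \<Rightarrow> real)
      \<Rightarrow> ('a \<Rightarrow> real) \<Rightarrow> bool" where
  "has_walsh_integral M W t X Y \<longleftrightarrow>
     (\<lambda>((s, y), \<omega>). X s y \<omega>) \<in> borel_measurable (slab t \<Otimes>\<^sub>M M) \<and>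
     Y \<in> borel_measurable M \<and>
     (\<exists>S. (\<forall>n. simple_process M W (S n)) \<and>
        (\<lambda>n. \<integral>\<^sup>+ (s, y). L2_norm_sq M (\<lambda>\<omega>. X s y \<omega> - simple_value (S n) s y \<omega>) \<partial>slab t)
          \<longlonglongrightarrow> 0 \<and>
        (\<lambda>n. L2_norm_sq M (\<lambda>\<omega>. Y \<omega> - simple_walsh_integral W t (S n) \<omega>)) \<longlonglongrightarrow> 0)"

definition wave_kernel :: "real \<Rightarrow> real \<Rightarrow> real \<Rightarrow> real" where
  "wave_kernel \<kappa> t x = 1 / 2 * indicator {0..} t * indicator {- (\<kappa> * t)..\<kappa> * t} x"

text \<open>The homogeneous solution for initial position \<open>g\<close> and initial velocity \<open>\<mu>(dx) = v(x) dx\<close>;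
  \<open>v\<close> may take negative values, so \<open>\<mu>\<close> may be a signed measure.\<close>

definition wave_J0 :: "real \<Rightarrow> (real \<Rightarrow> real) \<Rightarrow> (real \<Rightarrow> real) \<Rightarrow> real \<Rightarrow> real \<Rightarrow> real" where
  "wave_J0 \<kappa> g v t x =
     1 / 2 * (g (x + \<kappa> * t) + g (x - \<kappa> * t)) + (\<integral> y. wave_kernel \<kappa> t (x - y) * v y \<partial>lborel)"

definition wave_solution ::
    "'a measure \<Rightarrow> ((real \<times> real) set \<Rightarrow> 'a \<Rightarrow> real) \<Rightarrow> real \<Rightarrow> (real \<Rightarrow> real) \<Rightarrow> (real \<Rightarrow> real)
      \<Rightarrow> (real \<Rightarrow> real) \<Rightarrow> (real \<Rightarrow> real \<Rightarrow> 'a \<Rightarrow> real) \<Rightarrow> bool" where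
  "wave_solution M W \<kappa> \<rho> g v u \<longleftrightarrow>
     (\<forall>t\<ge>0. \<forall>x. u t x \<in> borel_measurable (noise_filtration M W t)) \<and>
     (\<lambda>((t, x), \<omega>). u t x \<omega>)
        \<in> borel_measurable (restrict_space borel ({0..} \<times> UNIV) \<Otimes>\<^sub>M M) \<and>
     (\<forall>t>0. \<forall>x. (\<integral>\<^sup>+ (s, y). ennreal ((wave_kernel \<kappa> (t - s) (x - y))\<^sup>2)
                     * L2_norm_sq M (\<lambda>\<omega>. \<rho> (u s y \<omega>)) \<partial>slab t) < \<infinity>) \<and>
     (\<exists>I :: real \<Rightarrow> real \<Rightarrow> 'a \<Rightarrow> real.
        (\<forall>t\<ge>0. \<forall>x. has_walsh_integral M W t
            (\<lambda>s y \<omega>. wave_kernel \<kappa> (t - s) (x - y) * \<rho> (u s y \<omega>)) (I t x)) \<and>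
        (\<forall>t\<ge>0. \<forall>x. ((\<lambda>(t', x'). L2_norm_sq M (\<lambda>\<omega>. I t' x' \<omega> - I t x \<omega>)) \<longlongrightarrow> 0)
            (at (t, x) within {0..} \<times> UNIV)) \<and>
        (\<forall>t\<ge>0. \<forall>x. AE \<omega> in M. u t x \<omega> = wave_J0 \<kappa> g v t x + I t x \<omega>))"

definition T_kappa :: "real \<Rightarrow> real \<Rightarrow> real \<Rightarrow> real" where
  "T_kappa \<kappa> t x = (t - \<bar>x\<bar> / (2 * \<kappa>)) * indicator {z. \<bar>z\<bar> \<le> 2 * \<kappa> * t} x"

definition H_fun :: "real \<Rightarrow> real \<Rightarrow> real \<Rightarrow> real" where
  "H_fun \<kappa> l t = cosh (\<bar>l\<bar> * sqrt (\<kappa> / 2) * t) - 1"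

end

theory Submission
  imports Defs
begin

text \<open>
  Write \<open>f(t,x) = \<parallel>u(t,x)\<parallel>\<^sup>2\<close> for the second moment. The Walsh integral is a centred isometry from
  \<open>L\<^sup>2([0,t] \<times> \<real> \<times> \<Omega>)\<close> into \<open>L\<^sup>2(\<Omega>)\<close>. The deterministic part is \<open>J\<^sub>0(t,x) = w + \<kappa>w't\<close>
  and \<open>\<rho>\<^sup>2\<close> is an affine function of the square, so that the isometry, polarised, turns the stochastic
  equation into the closed linear system
  \<open>E[u(t,x) u(t,y)] = (w + \<kappa>w't)\<^sup>2
     + \<integral>\<^sub>0\<^sup>t\<integral> G\<^sub>\<kappa>(t-s, x-z) G\<^sub>\<kappa>(t-s, y-z) \<lambda>\<^sup>2 (\<varsigma>\<^sup>2 + f(s,z)) dz ds\<close>.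
  For \<open>x = y\<close> this is an integral equation for \<open>f\<close> alone. It has at most one locally bounded solution:
  the kernel is supported in the backward light cone, which is compact, and a weight \<open>exp(\<beta>t)\<close> makes
  the integral operator a contraction there (\<open>cone_inequality_unique\<close>). Local boundedness of
  \<open>f\<close> comes from the \<open>L\<^sup>2\<close>-continuity required of a solution.

  It remains to exhibit a solution. The two light cones with apices \<open>(t,x)\<close> and \<open>(t,y)\<close> meet at time
  \<open>s\<close> in an interval of length \<open>2\<kappa>(T - s)\<^sub>+\<close> with \<open>T = T\<^sub>\<kappa>(t, x - y)\<close>. Integrating a function \<open>\<phi>(s)\<close>
  against the product of the kernels therefore amounts to solving \<open>\<psi>'' = (\<kappa>/2) \<phi>\<close> with zero initial data
  and evaluating \<open>\<psi>\<close> at \<open>T\<close> (\<open>has_bochner_integral_cone\<close>). If \<open>f\<close> depends on time only, the equation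
  becomes \<open>h'' = (\<kappa>\<lambda>\<^sup>2/2)(\<varsigma>\<^sup>2 + h) + 2\<kappa>\<^sup>2w'\<^sup>2\<close> with \<open>h(0) = w\<^sup>2\<close> and \<open>h'(0) = 2\<kappa>ww'\<close>, which is solved by the
  combination of hyperbolic functions in the theorem. Inserting \<open>f = h\<close> once more, now for
  \<open>x \<noteq> y\<close>, gives the covariance as \<open>(w + \<kappa>w't)\<^sup>2 - (w + \<kappa>w'T)\<^sup>2 + h(T)\<close>.

  The isometry is built from the axioms of the noise. The noise on \<open>(a,\<infinity>) \<times> \<real>\<close> is independent of the
  past up to time \<open>a\<close> (\<open>filtration_indep_future_noise\<close>), which yields the covariance of two elementary
  integrals (\<open>expectation_increment_product\<close>), hence the isometry on simple processes
  (\<open>simple_walsh_isometry\<close>) and, by passing to the limit in \<open>L\<^sup>2\<close>, the general one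
  (\<open>walsh_isometry\<close>, \<open>walsh_covariance\<close>).
\<close>

section \<open>Moments of white noise and its finite cylinders\<close>

text \<open>The atoms are the classes of the relation ``contained in the same members of the family''. They
  reduce statements about overlapping sets to disjoint ones, the only sets on which white noise is
  assumed to be independent. The empty set is left out so that a further set
  disjoint from all atoms, possibly empty, is never itself an atom.\<close>

lemma disjoint_atoms_of_finite_family:
  fixes \<S> :: "'b set set"
  assumes fin: "finite \<S>" and sub: "\<S> \<subseteq> sets N"
  shows "\<exists>\<A>. finite \<A> \<and> disjoint \<A> \<and> {} \<notin> \<A> \<and> \<A> \<subseteq> sets N \<and>
    (\<forall>A\<in>\<A>. \<exists>S\<in>\<S>. A \<subseteq> S) \<and> (\<forall>S\<in>\<S>. S = \<Union>{A \<in> \<A>. A \<subseteq> S})"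
proof -
  define atom where "atom x = {y \<in> \<Union>\<S>. \<forall>S\<in>\<S>. x \<in> S \<longleftrightarrow> y \<in> S}" for x
  define \<A> where "\<A> = atom ` \<Union>\<S>"
  have "\<A> \<subseteq> (\<lambda>F. {y \<in> \<Union>\<S>. \<forall>S\<in>\<S>. S \<in> F \<longleftrightarrow> y \<in> S}) ` Pow \<S>"
  proof
    fix A assume "A \<in> \<A>"
    then obtain x where "A = atom x" by (auto simp: \<A>_def)
    then have "A = {y \<in> \<Union>\<S>. \<forall>S\<in>\<S>. S \<in> {S\<in>\<S>. x \<in> S} \<longleftrightarrow> y \<in> S}"
      by (auto simp: atom_def)
    then show "A \<in> (\<lambda>F. {y \<in> \<Union>\<S>. \<forall>S\<in>\<S>. S \<in> F \<longleftrightarrow> y \<in> S}) ` Pow \<S>" by blast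
  qed
  then have 1: "finite \<A>" using fin finite_surj[of "Pow \<S>"] by blast
  have same: "atom x = atom z" if "z \<in> atom x" for x z
    using that unfolding atom_def by blast
  have 2: "disjoint \<A>"
  proof (rule disjointI)
    fix A B assume "A \<in> \<A>" "B \<in> \<A>" "A \<noteq> B"
    then show "A \<inter> B = {}" unfolding \<A>_def by (metis disjoint_iff imageE same)
  qed
  have 3: "{} \<notin> \<A>" by (auto simp: \<A>_def atom_def)
  have 4: "\<exists>S\<in>\<S>. A \<subseteq> S" if "A \<in> \<A>" for A
    using that unfolding \<A>_def atom_def by blast
  have 5: "A \<in> sets N" if A: "A \<in> \<A>" for A
  proof -
    obtain x where x: "x \<in> \<Union>\<S>" "A = atom x" using A by (auto simp: \<A>_def)
    have "A = \<Union>\<S> \<inter> (\<Inter>S\<in>\<S>. if x \<in> S then S else space N - S)"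
    proof (intro set_eqI iffI)
      fix y assume y: "y \<in> A"
      then have "y \<in> space N" using x sub sets.sets_into_space unfolding atom_def by blast
      then show "y \<in> \<Union>\<S> \<inter> (\<Inter>S\<in>\<S>. if x \<in> S then S else space N - S)"
        using y unfolding x(2) atom_def by auto
    next
      fix y assume y: "y \<in> \<Union>\<S> \<inter> (\<Inter>S\<in>\<S>. if x \<in> S then S else space N - S)"
      then have "y \<in> (if x \<in> S then S else space N - S)" if "S \<in> \<S>" for S
        using that by blast
      then show "y \<in> A" using y unfolding x(2) atom_def by (auto split: if_splits)
    qed
    also have "\<dots> \<in> sets N"
      using fin sub x(1) by (intro sets.Int sets.finite_Union sets.finite_INT) auto
    finally show ?thesis .
  qed
  have 6: "S = \<Union>{A \<in> \<A>. A \<subseteq> S}" if "S \<in> \<S>" for S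
  proof
    show "S \<subseteq> \<Union>{A \<in> \<A>. A \<subseteq> S}"
    proof
      fix x assume "x \<in> S"
      then have "atom x \<in> \<A>" "x \<in> atom x" "atom x \<subseteq> S"
        using that by (auto simp: \<A>_def atom_def)
      then show "x \<in> \<Union>{A \<in> \<A>. A \<subseteq> S}" by blast
    qed
  qed auto
  show ?thesis using 1 2 3 4 5 6 by blast
qed

lemma noise_setsI:
  "A \<in> sets borel \<Longrightarrow> A \<subseteq> {0..} \<times> UNIV \<Longrightarrow> emeasure lborel A < \<infinity> \<Longrightarrow> A \<in> noise_sets"
  by (simp add: noise_sets_def)

lemma noise_sets_subset:
  assumes "A \<in> noise_sets" "B \<in> sets borel" "B \<subseteq> A"
  shows "B \<in> noise_sets"
  using assms emeasure_mono[of B A lborel] by (auto simp: noise_sets_def less_top[symmetric] top_unique)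

lemma noise_sets_Un: "A \<in> noise_sets \<Longrightarrow> B \<in> noise_sets \<Longrightarrow> A \<union> B \<in> noise_sets"
  using emeasure_subadditive[of A lborel B]
  by (auto simp: noise_sets_def less_top[symmetric] top_unique)

lemma emeasure_rectangle:
  fixes A B :: "real set"
  assumes [measurable]: "A \<in> sets borel" "B \<in> sets borel"
  shows "emeasure lborel (A \<times> B) = emeasure lborel A * emeasure lborel B"
  using lborel.emeasure_pair_measure_Times[of A lborel B] by (simp add: lborel_prod)

lemma rectangle_in_noise_sets:
  assumes "A \<in> sets borel" "A \<subseteq> {0..r}" "B \<in> sets borel" "emeasure lborel B < \<infinity>"
  shows "A \<times> B \<in> noise_sets"
proof (rule noise_setsI)
  have "emeasure lborel A \<le> emeasure lborel {0..r}"
    using assms by (intro emeasure_mono) auto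
  then have "emeasure lborel A < \<infinity>"
    by (rule order.strict_trans1) (simp add: emeasure_lborel_Icc_eq)
  then show "emeasure lborel (A \<times> B) < \<infinity>"
    using assms by (simp add: emeasure_rectangle ennreal_mult_less_top)
  show "A \<times> B \<in> sets borel"
    using assms by (simp add: borel_Times)
  show "A \<times> B \<subseteq> {0..} \<times> UNIV"
    using assms(2) by auto
qed

text \<open>A family of sets cannot contain the same set twice, so two equal disjoint sets, both empty, need the
  fact that the noise of a null set vanishes.\<close>

lemma (in space_time_white_noise) noise_Un_disjoint:
  assumes "A \<in> noise_sets" "B \<in> noise_sets" "A \<inter> B = {}"
  shows "AE \<omega> in M. W (A \<union> B) \<omega> = W A \<omega> + W B \<omega>"
proof (cases "A = B")
  case True
  then have "A = {}" "B = {}" using assms by auto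
  moreover have "AE \<omega> in M. W {} \<omega> = 0"
    using noise_null[of "{}"] assms \<open>A = {}\<close> by simp
  ultimately show ?thesis by auto
next
  case False
  have "disjoint {A, B}" using assms(3) by (auto simp: disjoint_def pairwise_def disjnt_def)
  then show ?thesis
    using noise_additive[of "{A, B}"] assms False by simp
qed

text \<open>A null set has degenerate noise, whose moments do not come from a normal density.\<close>

lemma (in space_time_white_noise) noise_moments:
  assumes A: "A \<in> noise_sets"
  shows "integrable M (W A)" "expectation (W A) = 0"
    "integrable M (\<lambda>\<omega>. (W A \<omega>)\<^sup>2)" "expectation (\<lambda>\<omega>. (W A \<omega>)\<^sup>2) = measure lborel A"
proof -
  note [measurable] = noise_measurable[OF A]
  have "integrable M (W A) \<and> expectation (W A) = 0 \<and>
    integrable M (\<lambda>\<omega>. (W A \<omega>)\<^sup>2) \<and> expectation (\<lambda>\<omega>. (W A \<omega>)\<^sup>2) = measure lborel A"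
  proof (cases "measure lborel A = 0")
    case True
    have ae: "AE \<omega> in M. W A \<omega> = 0" by (rule noise_null[OF A True])
    then have ae2: "AE \<omega> in M. (W A \<omega>)\<^sup>2 = 0" by eventually_elim simp
    have "integrable M (W A)" "integrable M (\<lambda>\<omega>. (W A \<omega>)\<^sup>2)"
      using ae ae2 by (auto intro: integrable_cong_AE_imp[where g = "\<lambda>_. 0"])
    moreover have "expectation (W A) = 0" "expectation (\<lambda>\<omega>. (W A \<omega>)\<^sup>2) = 0"
      using ae ae2 by (auto intro: integral_eq_zero_AE)
    ultimately show ?thesis using True by auto
  next
    case False
    define s where "s = sqrt (measure lborel A)"
    have m: "measure lborel A > 0" using False measure_nonneg[of lborel A] by linarith
    then have s: "s > 0" "s\<^sup>2 = measure lborel A" by (auto simp: s_def)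
    have D: "distributed M lborel (W A) (\<lambda>x. ennreal (normal_density 0 s x))"
      using noise_gaussian[OF A m] by (simp add: s_def)
    have i1: "integrable M (\<lambda>\<omega>. (W A \<omega>)^k)" for k
      using integrable_normal_moment[OF s(1), of 0 k]
        distributed_integrable[OF D, of "\<lambda>x. x ^ k"] by simp
    have "expectation (W A) = 0" using normal_distributed_expectation[OF s(1) D] by simp
    moreover have "expectation (\<lambda>\<omega>. (W A \<omega>)\<^sup>2) = measure lborel A"
      using normal_distributed_variance[OF s(1) D] s(2) calculation by simp
    ultimately show ?thesis using i1[of 1] i1[of 2] by simp
  qed
  then show "integrable M (W A)" "expectation (W A) = 0"
    "integrable M (\<lambda>\<omega>. (W A \<omega>)\<^sup>2)" "expectation (\<lambda>\<omega>. (W A \<omega>)\<^sup>2) = measure lborel A" by auto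
qed

text \<open>Almost surely, every \<open>W S\<close> is the sum of \<open>W\<close> over the atoms contained in \<open>S\<close>. The atoms together
  with \<open>D\<close> form a disjoint family, to which the independence axiom applies.\<close>

lemma (in space_time_white_noise) noise_cylinder_indep:
  assumes fin: "finite \<S>" and sub: "\<S> \<subseteq> noise_sets" and D: "D \<in> noise_sets"
    and disj: "\<And>S. S \<in> \<S> \<Longrightarrow> S \<inter> D = {}"
    and C: "\<And>S. S \<in> \<S> \<Longrightarrow> C S \<in> sets borel" and C': "C' \<in> sets borel"
  shows "prob {\<omega> \<in> space M. (\<forall>S\<in>\<S>. W S \<omega> \<in> C S) \<and> W D \<omega> \<in> C'} =
    prob {\<omega> \<in> space M. \<forall>S\<in>\<S>. W S \<omega> \<in> C S} * prob {\<omega> \<in> space M. W D \<omega> \<in> C'}"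
proof -
  have sub': "\<S> \<subseteq> sets borel" using sub by (auto simp: noise_sets_def)
  obtain \<A> where fA: "finite \<A>" and dA: "disjoint \<A>" and eA: "{} \<notin> \<A>"
    and mA: "\<A> \<subseteq> sets borel"
    and inA: "\<forall>A\<in>\<A>. \<exists>S\<in>\<S>. A \<subseteq> S" and uA: "\<forall>S\<in>\<S>. S = \<Union>{A \<in> \<A>. A \<subseteq> S}"
    using disjoint_atoms_of_finite_family[OF fin sub'] by blast
  have nA: "\<A> \<subseteq> noise_sets"
  proof
    fix A assume A: "A \<in> \<A>"
    then obtain S where "S \<in> \<S>" "A \<subseteq> S" using inA by blast
    then show "A \<in> noise_sets" using noise_sets_subset[of S A] sub mA A by blast
  qed
  have DA: "A \<inter> D = {}" if "A \<in> \<A>" for A using inA that disj by blast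
  then have DnA: "D \<notin> \<A>" using eA by fastforce
  have dis: "disjoint (insert D \<A>)"
    using dA DA by (auto simp: disjoint_def)
  have ind: "indep_vars (\<lambda>_. borel) W (insert D \<A>)"
    using fA nA D dis by (intro noise_indep) auto
  have iv: "indep_var (PiM \<A> (\<lambda>_. borel)) (\<lambda>\<omega>. \<lambda>A\<in>\<A>. W A \<omega>)
      (PiM {D} (\<lambda>_. borel)) (\<lambda>\<omega>. \<lambda>A\<in>{D}. W A \<omega>)"
    using DnA by (intro indep_var_restrict[OF ind]) auto
  define Xa where "Xa = {f \<in> space (PiM \<A> (\<lambda>_. borel)). \<forall>S\<in>\<S>. (\<Sum>A\<in>{A\<in>\<A>. A \<subseteq> S}. f A) \<in> C S}"
  define Xb where "Xb = {f \<in> space (PiM {D} (\<lambda>_. borel)). f D \<in> C'}"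
  have Xa: "Xa \<in> sets (PiM \<A> (\<lambda>_. borel :: real measure))"
    unfolding Xa_def
  proof (rule sets.sets_Collect_finite_All[OF _ fin])
    fix S assume S: "S \<in> \<S>"
    have "(\<lambda>f. \<Sum>A\<in>{A\<in>\<A>. A \<subseteq> S}. f A) \<in> borel_measurable (PiM \<A> (\<lambda>_. borel :: real measure))"
      by (intro borel_measurable_sum measurable_component_singleton) auto
    from measurable_sets[OF this C[OF S]]
    show "{f \<in> space (PiM \<A> (\<lambda>_. borel)). (\<Sum>A\<in>{A\<in>\<A>. A \<subseteq> S}. f A) \<in> C S} \<in> sets (PiM \<A> (\<lambda>_. borel))"
      by (simp add: vimage_def Int_def conj_commute)
  qed
  have "(\<lambda>f. f D) \<in> measurable (PiM {D} (\<lambda>_. borel :: real measure)) borel" by simp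
  from measurable_sets[OF this C'] have Xb: "Xb \<in> sets (PiM {D} (\<lambda>_. borel :: real measure))"
    by (simp add: Xb_def vimage_def Int_def conj_commute)
  have ae: "AE \<omega> in M. \<forall>S\<in>\<S>. W S \<omega> = (\<Sum>A\<in>{A\<in>\<A>. A \<subseteq> S}. W A \<omega>)"
  proof (rule AE_finite_allI[OF fin])
    fix S assume S: "S \<in> \<S>"
    have "AE \<omega> in M. W (\<Union>{A\<in>\<A>. A \<subseteq> S}) \<omega> = (\<Sum>A\<in>{A\<in>\<A>. A \<subseteq> S}. W A \<omega>)"
      using fA nA dA by (intro noise_additive) (auto simp: disjoint_def)
    moreover have "\<Union>{A\<in>\<A>. A \<subseteq> S} = S" using uA S by metis
    ultimately show "AE \<omega> in M. W S \<omega> = (\<Sum>A\<in>{A\<in>\<A>. A \<subseteq> S}. W A \<omega>)"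
      by (simp only:)
  qed
  define E where "E = {\<omega> \<in> space M. \<forall>S\<in>\<S>. W S \<omega> \<in> C S}"
  define F where "F = {\<omega> \<in> space M. W D \<omega> \<in> C'}"
  define E' where "E' = (\<lambda>\<omega>. \<lambda>A\<in>\<A>. W A \<omega>) -` Xa \<inter> space M"
  have E'_eq: "E' = {\<omega> \<in> space M. \<forall>S\<in>\<S>. (\<Sum>A\<in>{A\<in>\<A>. A \<subseteq> S}. W A \<omega>) \<in> C S}"
  proof -
    have "(\<Sum>A\<in>{A\<in>\<A>. A \<subseteq> S}. (\<lambda>A\<in>\<A>. W A \<omega>) A) = (\<Sum>A\<in>{A\<in>\<A>. A \<subseteq> S}. W A \<omega>)" for S \<omega>
      by (rule sum.cong) auto
    then show ?thesis by (simp add: E'_def Xa_def space_PiM vimage_def Int_def conj_commute)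
  qed
  have mX: "(\<lambda>\<omega>. \<lambda>A\<in>\<A>. W A \<omega>) \<in> measurable M (PiM \<A> (\<lambda>_. borel))"
    using noise_measurable nA by (intro measurable_restrict) auto
  have mE': "E' \<in> events" unfolding E'_def using mX Xa by (rule measurable_sets)
  have mE: "E \<in> events"
    unfolding E_def
  proof (rule sets.sets_Collect_finite_All[OF _ fin])
    fix S assume S: "S \<in> \<S>"
    show "{\<omega> \<in> space M. W S \<omega> \<in> C S} \<in> events"
      using measurable_sets[OF noise_measurable C[OF S], of S] S sub
      by (auto simp: vimage_def Int_def conj_commute)
  qed
  have mF: "F \<in> events"
    using measurable_sets[OF noise_measurable[OF D] C'] by (simp add: F_def vimage_def Int_def conj_commute)
  have F_eq: "F = (\<lambda>\<omega>. \<lambda>A\<in>{D}. W A \<omega>) -` Xb \<inter> space M"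
    by (auto simp: F_def Xb_def space_PiM)
  have ae': "AE \<omega> in M. \<omega> \<in> E \<longleftrightarrow> \<omega> \<in> E'"
    using ae by eventually_elim (auto simp: E_def E'_eq)
  have "prob (E \<inter> F) = prob (E' \<inter> F)"
    using ae' mE mE' mF by (intro measure_eq_AE) auto
  also have "E' \<inter> F = (\<lambda>x. ((\<lambda>A\<in>\<A>. W A x), (\<lambda>A\<in>{D}. W A x))) -` (Xa \<times> Xb) \<inter> space M"
    unfolding E'_def F_eq by auto
  also have "prob \<dots> = prob E' * prob F"
    unfolding E'_def F_eq by (rule indep_varD[OF iv Xa Xb])
  also have "prob E' = prob E"
    using ae' mE mE' by (intro measure_eq_AE) auto
  finally show ?thesis
    by (simp add: E_def F_def Int_def conj_ac)
qed


section \<open>The filtration and its independence of the future noise\<close>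

lemma (in space_time_white_noise) noise_upto_measurable:
  assumes "0 \<le> s" "B \<in> sets borel" "emeasure lborel B < \<infinity>"
  shows "noise_upto W s B \<in> borel_measurable M"
  unfolding noise_upto_def
  using assms by (intro noise_measurable rectangle_in_noise_sets[where r = s]) auto

lemma (in space_time_white_noise) filtration_generators_subset:
  "{noise_upto W s B -` C \<inter> space M | s B C.
         0 \<le> s \<and> s \<le> t \<and> B \<in> sets borel \<and> emeasure lborel B < \<infinity> \<and> C \<in> sets borel}
      \<union> null_sets M \<subseteq> events"
  using measurable_sets[OF noise_upto_measurable] by auto

lemma (in space_time_white_noise) space_noise_filtration [simp]:
  "space (noise_filtration M W t) = space M"
  unfolding noise_filtration_def
  using order_trans[OF filtration_generators_subset sets.space_closed] by (rule space_measure_of)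

lemma (in space_time_white_noise) sets_noise_filtration:
  "sets (noise_filtration M W t) = sigma_sets (space M)
    ({noise_upto W s B -` C \<inter> space M | s B C.
         0 \<le> s \<and> s \<le> t \<and> B \<in> sets borel \<and> emeasure lborel B < \<infinity> \<and> C \<in> sets borel}
      \<union> null_sets M)"
  unfolding noise_filtration_def
  using order_trans[OF filtration_generators_subset sets.space_closed] by (rule sets_measure_of)

lemma (in space_time_white_noise) subalgebra_noise_filtration:
  "sets (noise_filtration M W t) \<subseteq> events"
  unfolding sets_noise_filtration
  using filtration_generators_subset[of t] by (rule sets.sigma_sets_subset)

lemma (in space_time_white_noise) measurable_from_filtration:
  "\<xi> \<in> borel_measurable (noise_filtration M W t) \<Longrightarrow> \<xi> \<in> borel_measurable M"
  using subalgebra_noise_filtration[of t] by (auto simp: measurable_def)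

lemma (in space_time_white_noise) noise_filtration_mono:
  assumes "s \<le> t" "\<xi> \<in> borel_measurable (noise_filtration M W s)"
  shows "\<xi> \<in> borel_measurable (noise_filtration M W t)"
proof -
  have "sets (noise_filtration M W s) \<subseteq> sets (noise_filtration M W t)"
    unfolding sets_noise_filtration
    by (rule sigma_sets_mono') (use assms(1) order_trans in blast)
  then show ?thesis using assms(2) by (auto simp: measurable_def)
qed

lemma (in space_time_white_noise) noise_upto_adapted:
  assumes "0 \<le> s" "s \<le> t" "B \<in> sets borel" "emeasure lborel B < \<infinity>"
  shows "noise_upto W s B \<in> borel_measurable (noise_filtration M W t)"
proof (rule measurableI)
  fix C :: "real set" assume "C \<in> sets borel"
  then show "noise_upto W s B -` C \<inter> space (noise_filtration M W t) \<in> sets (noise_filtration M W t)"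
    unfolding sets_noise_filtration space_noise_filtration
    using assms by (intro sigma_sets.Basic UnI1) auto
qed auto

lemma (in prob_space) indep_set_mono:
  assumes "indep_set A B" "A' \<subseteq> A" "B' \<subseteq> B"
  shows "indep_set A' B'"
  using assms indep_setD[OF assms(1)] indep_setD_ev1[OF assms(1)] indep_setD_ev2[OF assms(1)]
  by (intro indep_setI) (auto dest: subsetD)

text \<open>The past is generated by the noise of rectangles that lie below time \<open>a\<close>, hence are disjoint from \<open>D\<close>.
  Events that agree almost surely with a finite cylinder over sets disjoint from \<open>D\<close> form a system
  stable under intersection. It contains the generators of the filtration: a null event is
  the cylinder over the empty set with empty target. Independence extends from this system to the
  generated \<open>\<sigma>\<close>-algebra by Dynkin's argument.\<close>

lemma (in space_time_white_noise) filtration_indep_future_noise: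
  assumes D: "D \<in> noise_sets" "D \<subseteq> {a<..} \<times> UNIV"
  shows "indep_set (sets (noise_filtration M W a)) (sigma_sets (space M) {W D -` C \<inter> space M | C. C \<in> sets borel})"
proof -
  \<comment> \<open>\<open>cyl E \<S> C\<close>: up to a null set, \<open>E\<close> is the cylinder event with base \<open>\<S>\<close> and targets \<open>C\<close>.\<close>
  define cyl where "cyl E \<S> C \<longleftrightarrow> finite \<S> \<and> \<S> \<subseteq> noise_sets \<and> (\<forall>S\<in>\<S>. S \<inter> D = {}) \<and> range C \<subseteq> sets borel \<and>
    (AE \<omega> in M. \<omega> \<in> E \<longleftrightarrow> (\<forall>S\<in>\<S>. W S \<omega> \<in> C S))"
    for E \<S> and C :: "(real \<times> real) set \<Rightarrow> real set"
  define P where "P = {E \<in> events. \<exists>\<S> C. cyl E \<S> C}"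
  define Q where "Q = {W D -` C \<inter> space M | C. C \<in> sets borel}"
  have Qev: "Q \<subseteq> events" using measurable_sets[OF noise_measurable[OF D(1)]] by (auto simp: Q_def)
  have PQ: "indep_set P Q"
  proof (rule indep_setI)
    show "P \<subseteq> events" by (auto simp: P_def)
    show "Q \<subseteq> events" by (rule Qev)
  next
    fix E F assume "E \<in> P" "F \<in> Q"
    then obtain \<S> C C' where cyl: "cyl E \<S> C" and E: "E \<in> events" and C': "C' \<in> sets borel"
      and F: "F = W D -` C' \<inter> space M" by (auto simp: P_def Q_def)
    have fS: "finite \<S>" and nS: "\<S> \<subseteq> noise_sets" and dS: "\<And>S. S \<in> \<S> \<Longrightarrow> S \<inter> D = {}"
      and CS: "\<And>S. C S \<in> sets borel" and ae: "AE \<omega> in M. \<omega> \<in> E \<longleftrightarrow> (\<forall>S\<in>\<S>. W S \<omega> \<in> C S)"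
      using cyl by (auto simp: cyl_def)
    have mF: "F \<in> events" using \<open>F \<in> Q\<close> Qev by auto
    define E' where "E' = {\<omega> \<in> space M. \<forall>S\<in>\<S>. W S \<omega> \<in> C S}"
    have mE': "E' \<in> events"
      unfolding E'_def
    proof (rule sets.sets_Collect_finite_All[OF _ fS])
      fix S assume "S \<in> \<S>"
      then show "{\<omega> \<in> space M. W S \<omega> \<in> C S} \<in> events"
        using measurable_sets[OF noise_measurable CS[of S], of S] nS
        by (auto simp: vimage_def Int_def conj_commute)
    qed
    have "prob (E \<inter> F) = prob (E' \<inter> F)"
      using ae E mE' mF by (intro measure_eq_AE) (auto simp: E'_def)
    also have "E' \<inter> F = {\<omega> \<in> space M. (\<forall>S\<in>\<S>. W S \<omega> \<in> C S) \<and> W D \<omega> \<in> C'}"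
      by (auto simp: E'_def F)
    also have "prob \<dots> = prob E' * prob {\<omega> \<in> space M. W D \<omega> \<in> C'}"
      unfolding E'_def by (rule noise_cylinder_indep[OF fS nS D(1) dS CS C'])
    also have "{\<omega> \<in> space M. W D \<omega> \<in> C'} = F" by (auto simp: F)
    also have "prob E' = prob E"
      using ae E mE' by (intro measure_eq_AE) (auto simp: E'_def)
    finally show "prob (E \<inter> F) = prob E * prob F" .
  qed
  have Pst: "Int_stable P"
  proof (rule Int_stableI)
    fix E1 E2 assume "E1 \<in> P" "E2 \<in> P"
    then obtain \<S>1 C1 \<S>2 C2 where c: "cyl E1 \<S>1 C1" "cyl E2 \<S>2 C2" and E: "E1 \<in> events" "E2 \<in> events"
      by (auto simp: P_def)
    \<comment> \<open>A set that occurs in only one of the two bases is unconstrained by the other.\<close>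
    define C where "C S = (if S \<in> \<S>1 then C1 S else UNIV) \<inter> (if S \<in> \<S>2 then C2 S else UNIV)" for S
    have Cb: "C S \<in> sets borel" for S using c unfolding C_def cyl_def by (intro sets.Int) auto
    have *: "(\<forall>S\<in>\<S>1 \<union> \<S>2. W S \<omega> \<in> C S) \<longleftrightarrow> (\<forall>S\<in>\<S>1. W S \<omega> \<in> C1 S) \<and> (\<forall>S\<in>\<S>2. W S \<omega> \<in> C2 S)" for \<omega>
      unfolding C_def by auto
    have "AE \<omega> in M. \<omega> \<in> E1 \<inter> E2 \<longleftrightarrow> (\<forall>S\<in>\<S>1 \<union> \<S>2. W S \<omega> \<in> C S)"
      using c[unfolded cyl_def, THEN conjunct2, THEN conjunct2, THEN conjunct2, THEN conjunct2] unfolding *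
      by eventually_elim auto
    then have "cyl (E1 \<inter> E2) (\<S>1 \<union> \<S>2) C"
      using c Cb by (auto simp: cyl_def)
    then show "E1 \<inter> E2 \<in> P" using E by (auto simp: P_def)
  qed
  have Qst: "Int_stable Q"
  proof (rule Int_stableI)
    fix F1 F2 assume "F1 \<in> Q" "F2 \<in> Q"
    then obtain C1 C2 where "C1 \<in> sets borel" "C2 \<in> sets borel"
      "F1 = W D -` C1 \<inter> space M" "F2 = W D -` C2 \<inter> space M" by (auto simp: Q_def)
    then have "F1 \<inter> F2 = W D -` (C1 \<inter> C2) \<inter> space M" "C1 \<inter> C2 \<in> sets borel" by auto
    then show "F1 \<inter> F2 \<in> Q" unfolding Q_def by blast
  qed
  have ind: "indep_set (sigma_sets (space M) P) (sigma_sets (space M) Q)"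
    by (rule indep_set_sigma_sets[OF PQ Pst Qst])
  have "sets (noise_filtration M W a) \<subseteq> sigma_sets (space M) P"
    unfolding sets_noise_filtration
  proof (rule sigma_sets_mono', rule subsetI)
    fix E assume "E \<in> {noise_upto W s B -` C \<inter> space M | s B C.
         0 \<le> s \<and> s \<le> a \<and> B \<in> sets borel \<and> emeasure lborel B < \<infinity> \<and> C \<in> sets borel}
      \<union> null_sets M"
    then consider (noise) s B C where "0 \<le> s" "s \<le> a" "B \<in> sets borel" "emeasure lborel B < \<infinity>" "C \<in> sets borel"
        "E = noise_upto W s B -` C \<inter> space M"
      | (null) "E \<in> null_sets M" by blast
    then show "E \<in> P"
    proof cases
      case noise
      have "E \<in> events" using noise measurable_sets[OF noise_upto_measurable] by auto
      moreover have "cyl E {{0..s} \<times> B} (\<lambda>_. C)"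
        using noise D(2) rectangle_in_noise_sets[of "{0..s}" s B]
        by (auto simp: cyl_def noise_upto_def)
      ultimately show ?thesis by (auto simp: P_def)
    next
      case null
      have "AE \<omega> in M. \<omega> \<notin> E" using null by (rule AE_not_in)
      then have "cyl E {{}} (\<lambda>_. {})"
        by (auto simp: cyl_def intro!: noise_setsI)
      then show ?thesis using null by (auto simp: P_def)
    qed
  qed
  with ind show ?thesis
    unfolding Q_def[symmetric] by (rule indep_set_mono) simp
qed

lemma (in space_time_white_noise) indep_var_future_noise:
  assumes D: "D \<in> noise_sets" "D \<subseteq> {a<..} \<times> UNIV"
    and \<xi>: "\<xi> \<in> borel_measurable (noise_filtration M W a)"
  shows "indep_var borel \<xi> borel (W D)"
  unfolding indep_var_eq
proof (intro conjI)
  show "random_variable borel \<xi>" by (rule measurable_from_filtration[OF \<xi>])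
  show "random_variable borel (W D)" by (rule noise_measurable[OF D(1)])
  have "sigma_sets (space M) {\<xi> -` A \<inter> space M |A. A \<in> sets borel} \<subseteq> sets (noise_filtration M W a)"
    using sets.sigma_sets_subset[of "{\<xi> -` A \<inter> space M |A. A \<in> sets borel}" "noise_filtration M W a"]
      measurable_sets[OF \<xi>] by auto
  with filtration_indep_future_noise[OF D]
  show "indep_set (sigma_sets (space M) {\<xi> -` A \<inter> space M |A. A \<in> sets borel})
      (sigma_sets (space M) {W D -` A \<inter> space M |A. A \<in> sets borel})"
    by (rule indep_set_mono) simp
qed

lemma (in space_time_white_noise) expectation_times_future_noise:
  assumes D: "D \<in> noise_sets" "D \<subseteq> {a<..} \<times> UNIV"
    and \<xi>: "\<xi> \<in> borel_measurable (noise_filtration M W a)" and int: "integrable M \<xi>"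
  shows "integrable M (\<lambda>\<omega>. \<xi> \<omega> * W D \<omega>)" "expectation (\<lambda>\<omega>. \<xi> \<omega> * W D \<omega>) = 0"
    "integrable M (\<lambda>\<omega>. \<xi> \<omega> * (W D \<omega>)\<^sup>2)"
    "expectation (\<lambda>\<omega>. \<xi> \<omega> * (W D \<omega>)\<^sup>2) = expectation \<xi> * measure lborel D"
proof -
  have iv: "indep_var borel \<xi> borel (W D)" by (rule indep_var_future_noise[OF D \<xi>])
  have iv2: "indep_var borel \<xi> borel (\<lambda>\<omega>. (W D \<omega>)\<^sup>2)"
    using indep_var_compose[OF iv, of "\<lambda>x. x" borel "\<lambda>x. x\<^sup>2" borel] by (simp add: comp_def)
  note m = noise_moments[OF D(1)]
  show "integrable M (\<lambda>\<omega>. \<xi> \<omega> * W D \<omega>)" by (rule indep_var_integrable[OF iv int m(1)])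
  show "expectation (\<lambda>\<omega>. \<xi> \<omega> * W D \<omega>) = 0"
    using indep_var_lebesgue_integral[OF iv int m(1)] m(2) by simp
  show "integrable M (\<lambda>\<omega>. \<xi> \<omega> * (W D \<omega>)\<^sup>2)" by (rule indep_var_integrable[OF iv2 int m(3)])
  show "expectation (\<lambda>\<omega>. \<xi> \<omega> * (W D \<omega>)\<^sup>2) = expectation \<xi> * measure lborel D"
    using indep_var_lebesgue_integral[OF iv2 int m(3)] m(4) by simp
qed

section \<open>Covariance of noise increments\<close>

text \<open>Independence from the past is available for the noise of one set at a time; the product of two noises
  is reduced to that case by polarisation, \<open>2 W(D) W(D') = W(D \<union> D')\<^sup>2 - W(D)\<^sup>2 - W(D')\<^sup>2\<close>.\<close>

lemma (in space_time_white_noise) future_noise_orthogonal: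
  assumes D: "D \<in> noise_sets" "D \<subseteq> {a<..} \<times> UNIV" and D': "D' \<in> noise_sets" "D' \<subseteq> {a<..} \<times> UNIV"
    and disj: "D \<inter> D' = {}"
    and \<xi>: "\<xi> \<in> borel_measurable (noise_filtration M W a)" and int: "integrable M \<xi>"
  shows "has_bochner_integral M (\<lambda>\<omega>. \<xi> \<omega> * (W D \<omega> * W D' \<omega>)) 0"
proof -
  note [measurable] = measurable_from_filtration[OF \<xi>] noise_measurable[OF D(1)] noise_measurable[OF D'(1)]
  have U: "D \<union> D' \<in> noise_sets" "D \<union> D' \<subseteq> {a<..} \<times> UNIV" using D D' noise_sets_Un by auto
  have 1: "has_bochner_integral M (\<lambda>\<omega>. \<xi> \<omega> * (W E \<omega>)\<^sup>2) (expectation \<xi> * measure lborel E)"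
    if "E \<in> noise_sets" "E \<subseteq> {a<..} \<times> UNIV" for E
    using expectation_times_future_noise(3,4)[OF that \<xi> int] by (simp add: has_bochner_integral_iff)
  have "measure lborel (D \<union> D') = measure lborel D + measure lborel D'"
    using D(1) D'(1) disj by (intro measure_Union) (auto simp: noise_sets_def)
  then have "has_bochner_integral M (\<lambda>\<omega>. (\<xi> \<omega> * (W (D \<union> D') \<omega>)\<^sup>2 - \<xi> \<omega> * (W D \<omega>)\<^sup>2 - \<xi> \<omega> * (W D' \<omega>)\<^sup>2) / 2) 0"
    using has_bochner_integral_divide_zero[OF has_bochner_integral_diff[OF
        has_bochner_integral_diff[OF 1[OF U] 1[OF D]] 1[OF D']], of 2]
    by (simp add: algebra_simps)
  moreover have "AE \<omega> in M. (\<xi> \<omega> * (W (D \<union> D') \<omega>)\<^sup>2 - \<xi> \<omega> * (W D \<omega>)\<^sup>2 - \<xi> \<omega> * (W D' \<omega>)\<^sup>2) / 2 =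
      \<xi> \<omega> * (W D \<omega> * W D' \<omega>)"
    using noise_Un_disjoint[OF D(1) D'(1) disj]
    by eventually_elim (simp add: power2_eq_square algebra_simps)
  ultimately show ?thesis by (auto intro: has_bochner_integralI_AE)
qed

text \<open>Split \<open>D1\<close> and \<open>D2\<close> along their intersection: of the four products only the square of the common
  part contributes to the expectation.\<close>

lemma (in space_time_white_noise) expectation_times_future_noise_product:
  assumes D1: "D1 \<in> noise_sets" "D1 \<subseteq> {a<..} \<times> UNIV" and D2: "D2 \<in> noise_sets" "D2 \<subseteq> {a<..} \<times> UNIV"
    and \<xi>: "\<xi> \<in> borel_measurable (noise_filtration M W a)" and int: "integrable M \<xi>"
  shows "has_bochner_integral M (\<lambda>\<omega>. \<xi> \<omega> * (W D1 \<omega> * W D2 \<omega>)) (expectation \<xi> * measure lborel (D1 \<inter> D2))"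
proof -
  note [measurable] = measurable_from_filtration[OF \<xi>] noise_measurable[OF D1(1)] noise_measurable[OF D2(1)]
  define P where "P = D1 \<inter> D2"
  define Q where "Q = D1 - D2"
  define R where "R = D2 - D1"
  have b: "D1 \<in> sets borel" "D2 \<in> sets borel" using D1 D2 by (auto simp: noise_sets_def)
  have n: "P \<in> noise_sets" "Q \<in> noise_sets" "R \<in> noise_sets"
    using noise_sets_subset[OF D1(1), of P] noise_sets_subset[OF D1(1), of Q]
      noise_sets_subset[OF D2(1), of R] b by (auto simp: P_def Q_def R_def)
  have s: "P \<subseteq> {a<..} \<times> UNIV" "Q \<subseteq> {a<..} \<times> UNIV" "R \<subseteq> {a<..} \<times> UNIV"
    using D1 D2 by (auto simp: P_def Q_def R_def)
  have d: "P \<inter> Q = {}" "P \<inter> R = {}" "Q \<inter> R = {}" "Q \<inter> P = {}" and u: "P \<union> Q = D1" "P \<union> R = D2"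
    by (auto simp: P_def Q_def R_def)
  have "has_bochner_integral M (\<lambda>\<omega>. \<xi> \<omega> * (W P \<omega>)\<^sup>2) (expectation \<xi> * measure lborel P)"
    using expectation_times_future_noise(3,4)[OF n(1) s(1) \<xi> int] by (simp add: has_bochner_integral_iff)
  from has_bochner_integral_add[OF this has_bochner_integral_add[OF
      future_noise_orthogonal[OF n(1) s(1) n(3) s(3) d(2) \<xi> int]
      has_bochner_integral_add[OF future_noise_orthogonal[OF n(2) s(2) n(1) s(1) d(4) \<xi> int]
      future_noise_orthogonal[OF n(2) s(2) n(3) s(3) d(3) \<xi> int]]]]
  have "has_bochner_integral M (\<lambda>\<omega>. \<xi> \<omega> * (W P \<omega>)\<^sup>2 + (\<xi> \<omega> * (W P \<omega> * W R \<omega>) +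
      (\<xi> \<omega> * (W Q \<omega> * W P \<omega>) + \<xi> \<omega> * (W Q \<omega> * W R \<omega>)))) (expectation \<xi> * measure lborel P)"
    by simp
  moreover have "AE \<omega> in M. \<xi> \<omega> * (W P \<omega>)\<^sup>2 + (\<xi> \<omega> * (W P \<omega> * W R \<omega>) +
      (\<xi> \<omega> * (W Q \<omega> * W P \<omega>) + \<xi> \<omega> * (W Q \<omega> * W R \<omega>))) = \<xi> \<omega> * (W D1 \<omega> * W D2 \<omega>)"
    using noise_Un_disjoint[OF n(1,2) d(1)] noise_Un_disjoint[OF n(1,3) d(2)] unfolding u
    by eventually_elim (simp add: power2_eq_square algebra_simps)
  ultimately show ?thesis unfolding P_def[symmetric] by (auto intro: has_bochner_integralI_AE)
qed

definition noise_increment ::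
    "((real \<times> real) set \<Rightarrow> 'a \<Rightarrow> real) \<Rightarrow> real \<Rightarrow> real \<Rightarrow> real set \<Rightarrow> 'a \<Rightarrow> real" where
  "noise_increment W a b B \<omega> = noise_upto W b B \<omega> - noise_upto W a B \<omega>"

text \<open>An increment is defined through the process in time, whose adaptedness is immediate; up to null sets it is the noise of a
  strip to the right of \<open>a\<close>, whose independence of the past is known.\<close>

lemma (in space_time_white_noise) noise_increment_AE:
  assumes "0 \<le> a" "a \<le> b" "B \<in> sets borel" "emeasure lborel B < \<infinity>"
  shows "AE \<omega> in M. noise_increment W a b B \<omega> = W ({a<..b} \<times> B) \<omega>"
proof -
  have "{0..a} \<times> B \<in> noise_sets" "{a<..b} \<times> B \<in> noise_sets"
    using assms by (auto intro!: rectangle_in_noise_sets[where r = b])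
  moreover have "{0..a} \<times> B \<union> {a<..b} \<times> B = {0..b} \<times> B" "({0..a} \<times> B) \<inter> ({a<..b} \<times> B) = {}"
    using assms by auto
  ultimately have "AE \<omega> in M. W ({0..b} \<times> B) \<omega> = W ({0..a} \<times> B) \<omega> + W ({a<..b} \<times> B) \<omega>"
    using noise_Un_disjoint[of "{0..a} \<times> B" "{a<..b} \<times> B"] by simp
  then show ?thesis
    by eventually_elim (simp add: noise_increment_def noise_upto_def)
qed

lemma (in space_time_white_noise) noise_increment_adapted:
  assumes "0 \<le> a" "a \<le> b" "b \<le> t" "B \<in> sets borel" "emeasure lborel B < \<infinity>"
  shows "noise_increment W a b B \<in> borel_measurable (noise_filtration M W t)"
  unfolding noise_increment_def
  using assms by (intro borel_measurable_diff noise_upto_adapted) auto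

lemma (in space_time_white_noise) noise_increment_integrable:
  assumes "0 \<le> a" "a \<le> b" "B \<in> sets borel" "emeasure lborel B < \<infinity>"
  shows "integrable M (noise_increment W a b B)"
proof (rule integrable_cong_AE_imp)
  show "integrable M (W ({a<..b} \<times> B))"
    using assms by (intro noise_moments rectangle_in_noise_sets[where r = b]) auto
  show "noise_increment W a b B \<in> borel_measurable M"
    by (rule measurable_from_filtration[OF noise_increment_adapted[OF assms(1,2) order_refl assms(3,4)]])
  show "AE \<omega> in M. W ({a<..b} \<times> B) \<omega> = noise_increment W a b B \<omega>"
    using noise_increment_AE[OF assms] by eventually_elim simp
qed

lemma integrable_bounded_mult:
  fixes f g :: "'b \<Rightarrow> real"
  assumes g: "integrable M g" and f: "f \<in> borel_measurable M" and K: "\<exists>K. \<forall>\<omega>\<in>space M. \<bar>f \<omega>\<bar> \<le> K"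
  shows "integrable M (\<lambda>\<omega>. f \<omega> * g \<omega>)"
proof -
  obtain K where K: "\<And>\<omega>. \<omega> \<in> space M \<Longrightarrow> \<bar>f \<omega>\<bar> \<le> K" using K by blast
  show ?thesis
  proof (rule Bochner_Integration.integrable_bound)
    show "integrable M (\<lambda>\<omega>. K * g \<omega>)" using g by simp
    show "(\<lambda>\<omega>. f \<omega> * g \<omega>) \<in> borel_measurable M" using f g by measurable
    show "AE \<omega> in M. norm (f \<omega> * g \<omega>) \<le> norm (K * g \<omega>)"
      using K by (intro AE_I2) (fastforce simp: abs_mult intro!: mult_right_mono order_trans[OF K])
  qed
qed

lemma bounded_times:
  fixes f g :: "'b \<Rightarrow> real"
  assumes "\<exists>K. \<forall>\<omega>\<in>A. \<bar>f \<omega>\<bar> \<le> K" "\<exists>K. \<forall>\<omega>\<in>A. \<bar>g \<omega>\<bar> \<le> K"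
  shows "\<exists>K. \<forall>\<omega>\<in>A. \<bar>f \<omega> * g \<omega>\<bar> \<le> K"
proof -
  obtain K L where "\<And>\<omega>. \<omega> \<in> A \<Longrightarrow> \<bar>f \<omega>\<bar> \<le> K" "\<And>\<omega>. \<omega> \<in> A \<Longrightarrow> \<bar>g \<omega>\<bar> \<le> L" using assms by blast
  then have "\<bar>f \<omega> * g \<omega>\<bar> \<le> \<bar>K\<bar> * \<bar>L\<bar>" if "\<omega> \<in> A" for \<omega>
    unfolding abs_mult using that by (intro mult_mono) (auto intro: order_trans[OF _ abs_ge_self])
  then show ?thesis by blast
qed

lemma (in space_time_white_noise) expectation_times_increment:
  assumes "0 \<le> a" "a \<le> b" "B \<in> sets borel" "emeasure lborel B < \<infinity>"
    and \<xi>: "\<xi> \<in> borel_measurable (noise_filtration M W a)" and int: "integrable M \<xi>"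
  shows "has_bochner_integral M (\<lambda>\<omega>. \<xi> \<omega> * noise_increment W a b B \<omega>) 0"
proof -
  let ?D = "{a<..b} \<times> B"
  note [measurable] = measurable_from_filtration[OF \<xi>]
    measurable_from_filtration[OF noise_increment_adapted[OF assms(1,2) order_refl assms(3,4)]]
  have D: "?D \<in> noise_sets" "?D \<subseteq> {a<..} \<times> UNIV"
    using assms by (auto intro!: rectangle_in_noise_sets[where r = b])
  have 1: "has_bochner_integral M (\<lambda>\<omega>. \<xi> \<omega> * W ?D \<omega>) 0"
    using expectation_times_future_noise(1,2)[OF D \<xi> int] by (simp add: has_bochner_integral_iff)
  have 2: "AE \<omega> in M. \<xi> \<omega> * W ?D \<omega> = \<xi> \<omega> * noise_increment W a b B \<omega>"
    using noise_increment_AE[OF assms(1-4)] by eventually_elim simp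
  show ?thesis by (rule has_bochner_integralI_AE[OF 1 _ 2]) measurable
qed

text \<open>Say that the second increment starts later, at time \<open>a2\<close>. The part of the first one before \<open>a2\<close> belongs
  to the past and is orthogonal to the second increment. The part after \<open>a2\<close> has, given the past, the
  covariance of two future noises.\<close>

lemma (in space_time_white_noise) expectation_increment_product:
  assumes 1: "0 \<le> a1" "a1 \<le> b1" "B1 \<in> sets borel" "emeasure lborel B1 < \<infinity>"
      "\<xi>1 \<in> borel_measurable (noise_filtration M W a1)" "\<exists>K. \<forall>\<omega>\<in>space M. \<bar>\<xi>1 \<omega>\<bar> \<le> K"
    and 2: "a1 \<le> a2" "a2 \<le> b2" "B2 \<in> sets borel" "emeasure lborel B2 < \<infinity>"
      "\<xi>2 \<in> borel_measurable (noise_filtration M W a2)" "\<exists>K. \<forall>\<omega>\<in>space M. \<bar>\<xi>2 \<omega>\<bar> \<le> K"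
  shows "has_bochner_integral M
    (\<lambda>\<omega>. (\<xi>1 \<omega> * noise_increment W a1 b1 B1 \<omega>) * (\<xi>2 \<omega> * noise_increment W a2 b2 B2 \<omega>))
    (expectation (\<lambda>\<omega>. \<xi>1 \<omega> * \<xi>2 \<omega>) * measure lborel (({a1<..b1} \<inter> {a2<..b2}) \<times> (B1 \<inter> B2)))"
proof -
  define m where "m = min a2 b1"
  define c where "c = max a2 b1"
  \<comment> \<open>The first interval is \<open>(a1,m] \<union> (a2,c]\<close>, its parts before and after \<open>a2\<close>; the second is empty
    when \<open>b1 \<le> a2\<close>.\<close>
  define \<zeta> where "\<zeta> \<omega> = \<xi>1 \<omega> * \<xi>2 \<omega>" for \<omega>
  have m: "a1 \<le> m" "m \<le> a2" and c: "a2 \<le> c" using 1 2 by (auto simp: m_def c_def)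
  have a2: "0 \<le> a2" using 1 2 by simp
  have \<xi>1: "\<xi>1 \<in> borel_measurable (noise_filtration M W a2)"
    by (rule noise_filtration_mono[OF 2(1) 1(5)])
  have \<zeta>: "\<zeta> \<in> borel_measurable (noise_filtration M W a2)"
    unfolding \<zeta>_def using \<xi>1 2(5) by simp
  have \<zeta>b: "\<exists>K. \<forall>\<omega>\<in>space M. \<bar>\<zeta> \<omega>\<bar> \<le> K" unfolding \<zeta>_def by (rule bounded_times[OF 1(6) 2(6)])
  have \<zeta>i: "integrable M \<zeta>"
    using integrable_bounded_mult[of M "\<lambda>_. 1" \<zeta>, OF _ measurable_from_filtration[OF \<zeta>] \<zeta>b] by simp
  note ad = noise_increment_adapted[OF 1(1) m(1) m(2) 1(3,4)]
  have "(\<lambda>\<omega>. \<zeta> \<omega> * noise_increment W a1 m B1 \<omega>) \<in> borel_measurable (noise_filtration M W a2)"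
    using \<zeta> ad by simp
  moreover have "integrable M (\<lambda>\<omega>. \<zeta> \<omega> * noise_increment W a1 m B1 \<omega>)"
    by (rule integrable_bounded_mult[OF noise_increment_integrable[OF 1(1) m(1) 1(3,4)] measurable_from_filtration[OF \<zeta>] \<zeta>b])
  ultimately have I1: "has_bochner_integral M
      (\<lambda>\<omega>. \<zeta> \<omega> * noise_increment W a1 m B1 \<omega> * noise_increment W a2 b2 B2 \<omega>) 0"
    by (rule expectation_times_increment[OF a2 2(2-4)])
  let ?D1 = "{a2<..c} \<times> B1" and ?D2 = "{a2<..b2} \<times> B2"
  have D1: "?D1 \<in> noise_sets" "?D1 \<subseteq> {a2<..} \<times> UNIV"
    using a2 1 by (auto intro!: rectangle_in_noise_sets[where r = c])
  have D2: "?D2 \<in> noise_sets" "?D2 \<subseteq> {a2<..} \<times> UNIV"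
    using a2 2 by (auto intro!: rectangle_in_noise_sets[where r = b2])
  have I2: "has_bochner_integral M (\<lambda>\<omega>. \<zeta> \<omega> * (W ?D1 \<omega> * W ?D2 \<omega>)) (expectation \<zeta> * measure lborel (?D1 \<inter> ?D2))"
    by (rule expectation_times_future_noise_product[OF D1 D2 \<zeta> \<zeta>i])
  have inter: "?D1 \<inter> ?D2 = ({a1<..b1} \<inter> {a2<..b2}) \<times> (B1 \<inter> B2)"
    using 2(1) by (auto simp: c_def)
  have split: "noise_increment W a1 b1 B1 \<omega> = noise_increment W a1 m B1 \<omega> + noise_increment W a2 c B1 \<omega>" for \<omega>
    by (simp add: noise_increment_def m_def c_def min_def max_def)
  note [measurable] = measurable_from_filtration[OF 1(5)] measurable_from_filtration[OF 2(5)]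
    measurable_from_filtration[OF noise_increment_adapted[OF 1(1,2) order_refl 1(3,4)]]
    measurable_from_filtration[OF noise_increment_adapted[OF a2 2(2) order_refl 2(3,4)]]
  have "AE \<omega> in M. \<zeta> \<omega> * noise_increment W a1 m B1 \<omega> * noise_increment W a2 b2 B2 \<omega> + \<zeta> \<omega> * (W ?D1 \<omega> * W ?D2 \<omega>) =
      (\<xi>1 \<omega> * noise_increment W a1 b1 B1 \<omega>) * (\<xi>2 \<omega> * noise_increment W a2 b2 B2 \<omega>)"
    using noise_increment_AE[OF a2 c 1(3,4)] noise_increment_AE[OF a2 2(2-4)]
    by eventually_elim (simp add: split \<zeta>_def algebra_simps)
  from has_bochner_integralI_AE[OF has_bochner_integral_add[OF I1 I2] _ this]
  show ?thesis unfolding inter \<zeta>_def by simp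
qed

section \<open>The isometry for simple processes\<close>

lemma sigma_finite_slab: "sigma_finite_measure (slab t)"
  unfolding slab_def
  by (rule sigma_finite_measure_restrict_space[OF lborel.sigma_finite_measure_axioms]) (simp add: borel_Times)

lemma emeasure_slab:
  assumes "A \<in> sets borel"
  shows "emeasure (slab t) (A \<inter> {0..t} \<times> UNIV) = emeasure lborel (A \<inter> {0..t} \<times> UNIV)"
  unfolding slab_def using assms by (subst emeasure_restrict_space) (auto simp: borel_Times)

lemma space_slab [simp]: "space (slab t) = {0..t} \<times> UNIV"
  by (simp add: slab_def space_restrict_space)

lemma slab_measurable: "f \<in> measurable borel N \<Longrightarrow> f \<in> measurable (slab t) N"
  unfolding slab_def by (rule measurable_restrict_space1) simp

lemma has_bochner_integral_slab_product:
  assumes M: "prob_space M" and \<xi>: "\<xi> \<in> borel_measurable M" "\<exists>K. \<forall>\<omega>\<in>space M. \<bar>\<xi> \<omega>\<bar> \<le> K"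
    and R: "R \<in> sets borel" "emeasure lborel R < \<infinity>"
  shows "has_bochner_integral (slab t \<Otimes>\<^sub>M M) (\<lambda>(p, \<omega>). \<xi> \<omega> * indicator R p :: real)
    (integral\<^sup>L M \<xi> * measure lborel (R \<inter> {0..t} \<times> UNIV))"
proof -
  interpret prob_space M by fact
  interpret slab: sigma_finite_measure "slab t" by (rule sigma_finite_slab)
  interpret pair_sigma_finite "slab t" M ..
  let ?f = "\<lambda>(p, \<omega>). \<xi> \<omega> * indicator R p :: real"
  obtain K where K: "\<And>\<omega>. \<omega> \<in> space M \<Longrightarrow> \<bar>\<xi> \<omega>\<bar> \<le> K" using \<xi>(2) by blast
  have ind: "(\<lambda>p. indicator R p :: real) \<in> borel_measurable (slab t)"
    using R(1) by (intro slab_measurable) simp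
  note [measurable] = \<xi>(1)
  have [measurable]: "(\<lambda>x. indicator R (fst x) :: real) \<in> borel_measurable (slab t \<Otimes>\<^sub>M M)"
    using measurable_compose[OF measurable_fst ind, of M] by simp
  have f: "?f \<in> borel_measurable (slab t \<Otimes>\<^sub>M M)"
    unfolding case_prod_beta by measurable
  have i\<xi>: "integrable M \<xi>" using K \<xi>(1) by (intro integrable_const_bound[where B = K]) auto
  have eR: "emeasure (slab t) (R \<inter> {0..t} \<times> UNIV) < \<infinity>"
    using R emeasure_mono[of "R \<inter> {0..t} \<times> UNIV" R lborel]
    by (simp add: emeasure_slab)
  have sR: "R \<inter> {0..t} \<times> UNIV \<in> sets (slab t)"
    unfolding slab_def using R(1) by (auto simp: sets_restrict_space)
  have "has_bochner_integral (slab t) (indicator (R \<inter> {0..t} \<times> UNIV)) (measure lborel (R \<inter> {0..t} \<times> UNIV))"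
    using has_bochner_integral_real_indicator[OF sR eR] emeasure_slab[OF R(1), of t]
    by (simp add: measure_def)
  then have iR: "has_bochner_integral (slab t) (\<lambda>p. indicator R p :: real) (measure lborel (R \<inter> {0..t} \<times> UNIV))"
    by (subst has_bochner_integral_cong[OF refl _ refl, where g = "indicator (R \<inter> {0..t} \<times> UNIV)"])
       (auto simp: indicator_def)
  have int: "integrable (slab t \<Otimes>\<^sub>M M) ?f"
  proof (rule Fubini_integrable[OF f])
    show "integrable (slab t) (\<lambda>p. \<integral>\<omega>. norm (?f (p, \<omega>)) \<partial>M)"
      using iR by (simp add: abs_mult has_bochner_integral_iff)
    show "AE p in slab t. integrable M (\<lambda>\<omega>. ?f (p, \<omega>))" using i\<xi> by simp
  qed
  moreover have "integral\<^sup>L (slab t \<Otimes>\<^sub>M M) ?f = integral\<^sup>L M \<xi> * measure lborel (R \<inter> {0..t} \<times> UNIV)"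
    using integral_fst'[OF int] iR by (simp add: has_bochner_integral_iff)
  ultimately show ?thesis by (simp add: has_bochner_integral_iff)
qed

text \<open>The summands of \<^const>\<open>simple_value\<close> and \<^const>\<open>simple_walsh_integral\<close>, the former as a function
  on the product space, on which the isometry is stated.\<close>

definition elem_value :: "('a \<Rightarrow> real) \<times> real \<times> real \<times> real set \<Rightarrow> (real \<times> real) \<times> 'a \<Rightarrow> real" where
  "elem_value e = (\<lambda>((s, y), \<omega>). case e of (\<xi>, a, b, B) \<Rightarrow> \<xi> \<omega> * indicator {a<..b} s * indicator B y)"

definition elem_integral ::
    "((real \<times> real) set \<Rightarrow> 'a \<Rightarrow> real) \<Rightarrow> real \<Rightarrow> ('a \<Rightarrow> real) \<times> real \<times> real \<times> real set \<Rightarrow> 'a \<Rightarrow> real" where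
  "elem_integral W t e \<omega> = (case e of (\<xi>, a, b, B) \<Rightarrow>
     \<xi> \<omega> * (noise_upto W (min t b) B \<omega> - noise_upto W (min t a) B \<omega>))"

lemma simple_value_sum:
  "simple_value S s y \<omega> = (\<Sum>i<length S. elem_value (S ! i) ((s, y), \<omega>))"
  by (simp add: simple_value_def elem_value_def sum_list_sum_nth atLeast0LessThan case_prod_beta)

lemma simple_walsh_integral_sum:
  "simple_walsh_integral W t S \<omega> = (\<Sum>i<length S. elem_integral W t (S ! i) \<omega>)"
  by (simp add: simple_walsh_integral_def elem_integral_def sum_list_sum_nth atLeast0LessThan case_prod_beta)

text \<open>Truncation at \<open>t\<close> may end the interval before it starts; the maximum with \<open>a\<close> turns this case into
  an empty interval, which removes it from all later case distinctions.\<close>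

lemma elem_integral_increment:
  "a \<le> b \<Longrightarrow> elem_integral W t (\<xi>, a, b, B) \<omega> = \<xi> \<omega> * noise_increment W a (max a (min t b)) B \<omega>"
  by (auto simp: elem_integral_def noise_increment_def min_def max_def)

lemma simple_process_nth:
  assumes "simple_process M W S" "i < length S"
  shows "simple_process M W [S ! i]"
  using bspec[OF assms(1)[unfolded simple_process_def] nth_mem[OF assms(2)]]
  by (simp add: simple_process_def)

lemma (in space_time_white_noise) elem_integral_mean_zero:
  assumes "simple_process M W [e]"
  shows "has_bochner_integral M (elem_integral W t e) 0"
proof -
  obtain \<xi> a b B where e: "e = (\<xi>, a, b, B)" by (cases e) auto
  have v: "0 \<le> a" "a \<le> b" "B \<in> sets borel" "emeasure lborel B < \<infinity>"
      "\<xi> \<in> borel_measurable (noise_filtration M W a)" "\<exists>K. \<forall>\<omega>\<in>space M. \<bar>\<xi> \<omega>\<bar> \<le> K"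
    using assms by (auto simp: simple_process_def e)
  have "integrable M \<xi>"
    using integrable_bounded_mult[of M "\<lambda>_. 1" \<xi>, OF _ measurable_from_filtration[OF v(5)] v(6)] by simp
  then show ?thesis
    using expectation_times_increment[of a "max a (min t b)" B \<xi>] v
    unfolding e elem_integral_increment[OF v(2)] by simp
qed

text \<open>This value and the one in the next lemma coincide; their equality is the polarised isometry
  on elementary processes.\<close>

lemma (in space_time_white_noise) elem_integral_product:
  assumes e1: "simple_process M W [(\<xi>1, a1, b1, B1)]" and e2: "simple_process M W [(\<xi>2, a2, b2, B2)]"
  shows "has_bochner_integral M
    (\<lambda>\<omega>. elem_integral W t (\<xi>1, a1, b1, B1) \<omega> * elem_integral W t (\<xi>2, a2, b2, B2) \<omega>)
    (expectation (\<lambda>\<omega>. \<xi>1 \<omega> * \<xi>2 \<omega>) *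
      measure lborel ((({a1<..b1} \<inter> {a2<..b2}) \<times> (B1 \<inter> B2)) \<inter> {0..t} \<times> UNIV))"
  using e1 e2
proof (induction a1 a2 arbitrary: \<xi>1 b1 B1 \<xi>2 b2 B2 rule: linorder_wlog)
  case (le a1 a2)
  define c1 where "c1 = max a1 (min t b1)"
  define c2 where "c2 = max a2 (min t b2)"
  have v: "0 \<le> a1" "a1 \<le> b1" "B1 \<in> sets borel" "emeasure lborel B1 < \<infinity>"
      "\<xi>1 \<in> borel_measurable (noise_filtration M W a1)" "\<exists>K. \<forall>\<omega>\<in>space M. \<bar>\<xi>1 \<omega>\<bar> \<le> K"
      "0 \<le> a2" "a2 \<le> b2" "B2 \<in> sets borel" "emeasure lborel B2 < \<infinity>"
      "\<xi>2 \<in> borel_measurable (noise_filtration M W a2)" "\<exists>K. \<forall>\<omega>\<in>space M. \<bar>\<xi>2 \<omega>\<bar> \<le> K"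
    using le by (auto simp: simple_process_def)
  have "has_bochner_integral M
    (\<lambda>\<omega>. (\<xi>1 \<omega> * noise_increment W a1 c1 B1 \<omega>) * (\<xi>2 \<omega> * noise_increment W a2 c2 B2 \<omega>))
    (expectation (\<lambda>\<omega>. \<xi>1 \<omega> * \<xi>2 \<omega>) * measure lborel (({a1<..c1} \<inter> {a2<..c2}) \<times> (B1 \<inter> B2)))"
    using v le(1) by (intro expectation_increment_product) (auto simp: c1_def c2_def)
  moreover have "({a1<..c1} \<inter> {a2<..c2}) \<times> (B1 \<inter> B2) = (({a1<..b1} \<inter> {a2<..b2}) \<times> (B1 \<inter> B2)) \<inter> {0..t} \<times> UNIV"
    using v(1) le(1) by (auto simp: c1_def c2_def)
  ultimately show ?case
    using v by (simp add: elem_integral_increment c1_def c2_def)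
next
  case (sym a1 a2)
  from sym(1)[OF sym(3,2)] show ?case by (simp add: mult.commute Int_commute)
qed

lemma (in space_time_white_noise) elem_value_product:
  assumes e1: "simple_process M W [(\<xi>1, a1, b1, B1)]" and e2: "simple_process M W [(\<xi>2, a2, b2, B2)]"
  shows "has_bochner_integral (slab t \<Otimes>\<^sub>M M)
    (\<lambda>p. elem_value (\<xi>1, a1, b1, B1) p * elem_value (\<xi>2, a2, b2, B2) p)
    (expectation (\<lambda>\<omega>. \<xi>1 \<omega> * \<xi>2 \<omega>) *
      measure lborel ((({a1<..b1} \<inter> {a2<..b2}) \<times> (B1 \<inter> B2)) \<inter> {0..t} \<times> UNIV))"
proof -
  let ?R = "({a1<..b1} \<inter> {a2<..b2}) \<times> (B1 \<inter> B2)"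
  have v: "0 \<le> a1" "B1 \<in> sets borel" "emeasure lborel B1 < \<infinity>"
      "\<xi>1 \<in> borel_measurable (noise_filtration M W a1)" "\<exists>K. \<forall>\<omega>\<in>space M. \<bar>\<xi>1 \<omega>\<bar> \<le> K"
      "B2 \<in> sets borel"
      "\<xi>2 \<in> borel_measurable (noise_filtration M W a2)" "\<exists>K. \<forall>\<omega>\<in>space M. \<bar>\<xi>2 \<omega>\<bar> \<le> K"
    using e1 e2 by (auto simp: simple_process_def)
  have "emeasure lborel (B1 \<inter> B2) \<le> emeasure lborel B1" using v by (intro emeasure_mono) auto
  then have "?R \<in> noise_sets"
    using v by (intro rectangle_in_noise_sets[where r = b1]) auto
  then have R: "?R \<in> sets borel" "emeasure lborel ?R < \<infinity>" by (auto simp: noise_sets_def)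
  have "has_bochner_integral (slab t \<Otimes>\<^sub>M M) (\<lambda>(p, \<omega>). (\<xi>1 \<omega> * \<xi>2 \<omega>) * indicator ?R p :: real)
     (expectation (\<lambda>\<omega>. \<xi>1 \<omega> * \<xi>2 \<omega>) * measure lborel (?R \<inter> {0..t} \<times> UNIV))"
    by (rule has_bochner_integral_slab_product[OF prob_space_axioms _ bounded_times[OF v(5,8)] R])
      (intro borel_measurable_times measurable_from_filtration[OF v(4)] measurable_from_filtration[OF v(7)])
  moreover have "(\<lambda>(p, \<omega>). (\<xi>1 \<omega> * \<xi>2 \<omega>) * indicator ?R p :: real) =
      (\<lambda>p. elem_value (\<xi>1, a1, b1, B1) p * elem_value (\<xi>2, a2, b2, B2) p)"
    by (auto simp: fun_eq_iff elem_value_def indicator_def)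
  ultimately show ?thesis by simp
qed

lemma (in space_time_white_noise) simple_walsh_integral_mean_zero:
  assumes "simple_process M W S"
  shows "has_bochner_integral M (simple_walsh_integral W t S) 0"
  unfolding simple_walsh_integral_sum
  using has_bochner_integral_sum[of "{..<length S}" M "\<lambda>i. elem_integral W t (S ! i)" "\<lambda>_. 0"]
    elem_integral_mean_zero[OF simple_process_nth[OF assms]] by simp

lemma (in space_time_white_noise) simple_walsh_isometry:
  assumes S: "simple_process M W S"
  shows "\<exists>c. has_bochner_integral M (\<lambda>\<omega>. (simple_walsh_integral W t S \<omega>)\<^sup>2) c \<and>
    has_bochner_integral (slab t \<Otimes>\<^sub>M M) (\<lambda>((s, y), \<omega>). (simple_value S s y \<omega>)\<^sup>2) c"
proof -
  have ex: "\<exists>c. has_bochner_integral M (\<lambda>\<omega>. elem_integral W t (S ! i) \<omega> * elem_integral W t (S ! j) \<omega>) c \<and>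
    has_bochner_integral (slab t \<Otimes>\<^sub>M M) (\<lambda>p. elem_value (S ! i) p * elem_value (S ! j) p) c"
    if "i < length S" "j < length S" for i j
    using simple_process_nth[OF S that(1)] simple_process_nth[OF S that(2)]
    by (cases "S ! i"; cases "S ! j") (auto intro: elem_integral_product elem_value_product)
  define c where "c i j = expectation (\<lambda>\<omega>. elem_integral W t (S ! i) \<omega> * elem_integral W t (S ! j) \<omega>)" for i j
  have c: "has_bochner_integral M (\<lambda>\<omega>. elem_integral W t (S ! i) \<omega> * elem_integral W t (S ! j) \<omega>) (c i j)"
    "has_bochner_integral (slab t \<Otimes>\<^sub>M M) (\<lambda>p. elem_value (S ! i) p * elem_value (S ! j) p) (c i j)"
    if "i < length S" "j < length S" for i j
    using ex[OF that] unfolding c_def by (auto dest: has_bochner_integral_integral_eq)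
  have "has_bochner_integral M (\<lambda>\<omega>. \<Sum>i<length S. \<Sum>j<length S. elem_integral W t (S ! i) \<omega> * elem_integral W t (S ! j) \<omega>)
      (\<Sum>i<length S. \<Sum>j<length S. c i j)"
    by (intro has_bochner_integral_sum c) auto
  moreover have "has_bochner_integral (slab t \<Otimes>\<^sub>M M)
      (\<lambda>p. \<Sum>i<length S. \<Sum>j<length S. elem_value (S ! i) p * elem_value (S ! j) p)
      (\<Sum>i<length S. \<Sum>j<length S. c i j)"
    by (intro has_bochner_integral_sum c) auto
  moreover have "(\<lambda>p. \<Sum>i<length S. \<Sum>j<length S. elem_value (S ! i) p * elem_value (S ! j) p) =
      (\<lambda>((s, y), \<omega>). (simple_value S s y \<omega>)\<^sup>2)"
    by (auto simp: fun_eq_iff simple_value_sum power2_eq_square sum_product)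
  ultimately show ?thesis
    by (intro exI[of _ "\<Sum>i<length S. \<Sum>j<length S. c i j"]) (auto simp: simple_walsh_integral_sum power2_eq_square sum_product)
qed

section \<open>The isometry for the Walsh integral\<close>

lemma square_sum_le: "(x + y)\<^sup>2 \<le> 2 * x\<^sup>2 + 2 * y\<^sup>2" for x y :: real
  using zero_le_power2[of "x - y"] by (simp add: power2_eq_square algebra_simps)

lemma integrable_square_add:
  fixes f g :: "'b \<Rightarrow> real"
  assumes [measurable]: "f \<in> borel_measurable N" "g \<in> borel_measurable N"
    and i: "integrable N (\<lambda>x. (f x)\<^sup>2)" "integrable N (\<lambda>x. (g x)\<^sup>2)"
  shows "integrable N (\<lambda>x. (f x + g x)\<^sup>2)"
proof (rule Bochner_Integration.integrable_bound)
  show "integrable N (\<lambda>x. 2 * (f x)\<^sup>2 + 2 * (g x)\<^sup>2)" using i by simp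
  show "AE x in N. norm ((f x + g x)\<^sup>2) \<le> norm (2 * (f x)\<^sup>2 + 2 * (g x)\<^sup>2)"
    using square_sum_le by simp
qed measurable

lemma integrable_product_of_squares:
  fixes f g :: "'b \<Rightarrow> real"
  assumes [measurable]: "f \<in> borel_measurable N" "g \<in> borel_measurable N"
    and i: "integrable N (\<lambda>x. (f x)\<^sup>2)" "integrable N (\<lambda>x. (g x)\<^sup>2)"
  shows "integrable N (\<lambda>x. f x * g x)"
proof -
  have "integrable N (\<lambda>x. ((f x + g x)\<^sup>2 - (f x)\<^sup>2 - (g x)\<^sup>2) / 2)"
    using integrable_square_add[OF assms] i by simp
  then show ?thesis by (simp add: power2_eq_square algebra_simps)
qed

lemma integrable_square_iff:
  fixes f :: "'b \<Rightarrow> real"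
  assumes "f \<in> borel_measurable N"
  shows "integrable N (\<lambda>x. (f x)\<^sup>2) \<longleftrightarrow> (\<integral>\<^sup>+x. ennreal ((f x)\<^sup>2) \<partial>N) < \<infinity>"
  using assms by (simp add: integrable_iff_bounded)

text \<open>From \<open>y\<^sup>2 - x\<^sup>2 = (x - y)\<^sup>2 - 2x(x - y)\<close> and Young's inequality. It serves as a substitute for the triangle
  inequality of the \<open>L\<^sup>2\<close>-norm.\<close>

lemma square_diff_bound:
  fixes x y \<eta> :: real
  assumes "\<eta> > 0"
  shows "\<bar>y\<^sup>2 - x\<^sup>2\<bar> \<le> \<eta> * x\<^sup>2 + (1 + 1 / \<eta>) * (x - y)\<^sup>2"
proof -
  have s: "sqrt \<eta> * sqrt \<eta> = \<eta>" "sqrt \<eta> > 0" using assms by auto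
  have "(sqrt \<eta> * x + (x - y) / sqrt \<eta>)\<^sup>2 = \<eta> * x\<^sup>2 + 2 * x * (x - y) + (x - y)\<^sup>2 / \<eta>"
    "(sqrt \<eta> * x - (x - y) / sqrt \<eta>)\<^sup>2 = \<eta> * x\<^sup>2 - 2 * x * (x - y) + (x - y)\<^sup>2 / \<eta>"
    using s assms by (simp_all add: power2_sum power2_diff power_mult_distrib power_divide)
  then have "\<bar>2 * x * (x - y)\<bar> \<le> \<eta> * x\<^sup>2 + (x - y)\<^sup>2 / \<eta>"
    using zero_le_power2[of "sqrt \<eta> * x + (x - y) / sqrt \<eta>"] zero_le_power2[of "sqrt \<eta> * x - (x - y) / sqrt \<eta>"]
    by linarith
  moreover have "y\<^sup>2 - x\<^sup>2 = (x - y)\<^sup>2 - 2 * x * (x - y)"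
    by (simp add: power2_eq_square algebra_simps)
  moreover have "0 \<le> (x - y)\<^sup>2" by simp
  ultimately have "\<bar>y\<^sup>2 - x\<^sup>2\<bar> \<le> (x - y)\<^sup>2 + (\<eta> * x\<^sup>2 + (x - y)\<^sup>2 / \<eta>)" by linarith
  also have "\<dots> = \<eta> * x\<^sup>2 + (1 + 1 / \<eta>) * (x - y)\<^sup>2" by (simp add: algebra_simps)
  finally show ?thesis .
qed

text \<open>Continuity of the squared \<open>L\<^sup>2\<close>-norm. It is used along sequences of simple processes, and along a
  neighbourhood filter for the continuity of the second moment of the solution.\<close>

lemma tendsto_integral_square:
  fixes f :: "'b \<Rightarrow> real" and g :: "'i \<Rightarrow> 'b \<Rightarrow> real"
  assumes f: "f \<in> borel_measurable N" and g: "\<forall>\<^sub>F i in F. g i \<in> borel_measurable N"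
    and i: "integrable N (\<lambda>x. (f x)\<^sup>2)"
    and lim: "((\<lambda>i. \<integral>\<^sup>+x. ennreal ((f x - g i x)\<^sup>2) \<partial>N) \<longlongrightarrow> 0) F"
  shows "((\<lambda>i. \<integral>x. (g i x)\<^sup>2 \<partial>N) \<longlongrightarrow> (\<integral>x. (f x)\<^sup>2 \<partial>N)) F"
proof (rule tendstoI)
  fix \<epsilon> :: real assume \<epsilon>: "\<epsilon> > 0"
  define A where "A = (\<integral>x. (f x)\<^sup>2 \<partial>N)"
  have A: "A \<ge> 0" by (simp add: A_def)
  \<comment> \<open>Chosen so that \<open>\<eta> A \<le> \<epsilon>/2\<close>; adding \<open>1\<close> avoids a division by zero.\<close>
  define \<eta> where "\<eta> = \<epsilon> / (2 * (A + 1))"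
  have \<eta>: "\<eta> > 0" using A \<epsilon> by (simp add: \<eta>_def)
  have \<eta>A: "\<eta> * A \<le> \<epsilon> / 2" using A \<epsilon> by (simp add: \<eta>_def field_simps)
  define c where "c = 1 + 1 / \<eta>"
  have c: "c > 0" using \<eta> by (simp add: c_def add_pos_pos)
  have "\<forall>\<^sub>F i in F. (\<integral>\<^sup>+x. ennreal ((f x - g i x)\<^sup>2) \<partial>N) < ennreal (\<epsilon> / (2 * c))"
    using order_tendstoD(2)[OF lim] \<epsilon> c by simp
  then show "\<forall>\<^sub>F i in F. dist (\<integral>x. (g i x)\<^sup>2 \<partial>N) A < \<epsilon>" unfolding A_def[symmetric] using g
  proof eventually_elim
    case (elim i)
    note [measurable] = f elim(2)
    have d: "integrable N (\<lambda>x. (f x - g i x)\<^sup>2)"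
      using elim(1) by (subst integrable_square_iff) (auto intro: order.strict_trans)
    have dl: "(\<integral>x. (f x - g i x)\<^sup>2 \<partial>N) < \<epsilon> / (2 * c)"
      using elim(1) nn_integral_eq_integral[OF d] \<epsilon> c by (simp add: ennreal_less_iff)
    have gi: "integrable N (\<lambda>x. (g i x)\<^sup>2)"
      using integrable_square_add[of f N "\<lambda>x. - (f x - g i x)"] i d by (simp add: power2_commute)
    have "\<bar>(\<integral>x. (g i x)\<^sup>2 \<partial>N) - A\<bar> = \<bar>\<integral>x. (g i x)\<^sup>2 - (f x)\<^sup>2 \<partial>N\<bar>"
      using gi i by (simp add: A_def)
    also have "\<dots> \<le> (\<integral>x. \<bar>(g i x)\<^sup>2 - (f x)\<^sup>2\<bar> \<partial>N)" by (rule integral_abs_bound)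
    also have "\<dots> \<le> (\<integral>x. \<eta> * (f x)\<^sup>2 + c * (f x - g i x)\<^sup>2 \<partial>N)"
      using gi i d square_diff_bound[OF \<eta>] unfolding c_def by (intro integral_mono) auto
    also have "\<dots> = \<eta> * A + c * (\<integral>x. (f x - g i x)\<^sup>2 \<partial>N)" using i d by (simp add: A_def)
    also have "\<dots> < \<epsilon> / 2 + c * (\<epsilon> / (2 * c))" by (intro add_le_less_mono \<eta>A mult_strict_left_mono dl c)
    also have "\<dots> = \<epsilon>" using c by simp
    finally show ?case by (simp add: dist_real_def)
  qed
qed

lemma iterated_L2_norm_sq:
  assumes M: "prob_space M" and F: "(\<lambda>((s, y), \<omega>). F s y \<omega>) \<in> borel_measurable (slab t \<Otimes>\<^sub>M M)"
  shows "(\<integral>\<^sup>+ (s, y). L2_norm_sq M (F s y) \<partial>slab t) = (\<integral>\<^sup>+ ((s, y), \<omega>). ennreal ((F s y \<omega>)\<^sup>2) \<partial>(slab t \<Otimes>\<^sub>M M))"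
proof -
  interpret prob_space M by fact
  have "(\<lambda>((s, y), \<omega>). ennreal ((F s y \<omega>)\<^sup>2)) \<in> borel_measurable (slab t \<Otimes>\<^sub>M M)"
    using F unfolding case_prod_beta' by measurable
  from nn_integral_fst[OF this] show ?thesis
    by (simp add: L2_norm_sq_def case_prod_beta')
qed

lemma simple_walsh_integral_append:
  "simple_walsh_integral W t (S @ S') \<omega> = simple_walsh_integral W t S \<omega> + simple_walsh_integral W t S' \<omega>"
  by (simp add: simple_walsh_integral_def)

lemma simple_value_append: "simple_value (S @ S') s y \<omega> = simple_value S s y \<omega> + simple_value S' s y \<omega>"
  by (simp add: simple_value_def)

lemma simple_process_append:
  "simple_process M W S \<Longrightarrow> simple_process M W S' \<Longrightarrow> simple_process M W (S @ S')"
  by (auto simp: simple_process_def)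

lemma (in space_time_white_noise) simple_value_measurable:
  assumes S: "simple_process M W S"
  shows "(\<lambda>((s, y), \<omega>). simple_value S s y \<omega>) \<in> borel_measurable (slab t \<Otimes>\<^sub>M M)"
proof -
  have "elem_value (S ! i) \<in> borel_measurable (slab t \<Otimes>\<^sub>M M)" if i: "i < length S" for i
  proof -
    obtain \<xi> a b B where e: "S ! i = (\<xi>, a, b, B)" by (cases "S ! i") auto
    have v: "B \<in> sets borel" "\<xi> \<in> borel_measurable (noise_filtration M W a)"
      using simple_process_nth[OF S i] by (auto simp: simple_process_def e)
    have "(\<lambda>p::real\<times>real. indicator ({a<..b} \<times> B) p :: real) \<in> borel_measurable (slab t)"
      using v by (intro slab_measurable borel_measurable_indicator) (simp add: borel_Times)
    from measurable_compose[OF measurable_fst this, of M]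
    have [measurable]: "(\<lambda>x. indicator ({a<..b} \<times> B) (fst x) :: real) \<in> borel_measurable (slab t \<Otimes>\<^sub>M M)" by simp
    note [measurable] = measurable_from_filtration[OF v(2)]
    have "elem_value (S ! i) = (\<lambda>x. \<xi> (snd x) * indicator ({a<..b} \<times> B) (fst x))"
      by (auto simp: e elem_value_def fun_eq_iff indicator_def)
    then show ?thesis by simp
  qed
  then have "(\<lambda>p. \<Sum>i<length S. elem_value (S ! i) p) \<in> borel_measurable (slab t \<Otimes>\<^sub>M M)"
    by (intro borel_measurable_sum) auto
  then show ?thesis by (simp add: simple_value_sum case_prod_beta')
qed

lemma (in space_time_white_noise) simple_walsh_integral_measurable:
  assumes S: "simple_process M W S"
  shows "simple_walsh_integral W t S \<in> borel_measurable M"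
  using simple_walsh_integral_mean_zero[OF S, of t] borel_measurable_has_bochner_integral by blast

lemma has_walsh_integralD:
  assumes "has_walsh_integral M W t X Y"
  shows "(\<lambda>((s, y), \<omega>). X s y \<omega>) \<in> borel_measurable (slab t \<Otimes>\<^sub>M M)" "Y \<in> borel_measurable M"
  using assms by (auto simp: has_walsh_integral_def)

lemma (in space_time_white_noise) has_walsh_integralE:
  assumes "has_walsh_integral M W t X Y"
  obtains S where "\<And>n. simple_process M W (S n)"
    "(\<lambda>n. \<integral>\<^sup>+ ((s, y), \<omega>). ennreal ((X s y \<omega> - simple_value (S n) s y \<omega>)\<^sup>2) \<partial>(slab t \<Otimes>\<^sub>M M)) \<longlonglongrightarrow> 0"
    "(\<lambda>n. \<integral>\<^sup>+ \<omega>. ennreal ((Y \<omega> - simple_walsh_integral W t (S n) \<omega>)\<^sup>2) \<partial>M) \<longlonglongrightarrow> 0"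
proof -
  obtain S where S: "\<And>n. simple_process M W (S n)"
    and 1: "(\<lambda>n. \<integral>\<^sup>+ (s, y). L2_norm_sq M (\<lambda>\<omega>. X s y \<omega> - simple_value (S n) s y \<omega>) \<partial>slab t) \<longlonglongrightarrow> 0"
    and 2: "(\<lambda>n. L2_norm_sq M (\<lambda>\<omega>. Y \<omega> - simple_walsh_integral W t (S n) \<omega>)) \<longlonglongrightarrow> 0"
    using assms by (auto simp: has_walsh_integral_def)
  have m: "(\<lambda>((s, y), \<omega>). X s y \<omega> - simple_value (S n) s y \<omega>) \<in> borel_measurable (slab t \<Otimes>\<^sub>M M)" for n
    using has_walsh_integralD(1)[OF assms] simple_value_measurable[OF S[of n], of t]
    unfolding case_prod_beta' by measurable
  show ?thesis
    using that[OF S] 1 2 iterated_L2_norm_sq[OF prob_space_axioms m] by (simp add: L2_norm_sq_def)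
qed

text \<open>Concatenating the two approximating lists adds both their values and their integrals.\<close>

lemma (in space_time_white_noise) has_walsh_integral_add:
  assumes w: "has_walsh_integral M W t X Y" and w': "has_walsh_integral M W t X' Y'"
  shows "has_walsh_integral M W t (\<lambda>s y \<omega>. X s y \<omega> + X' s y \<omega>) (\<lambda>\<omega>. Y \<omega> + Y' \<omega>)"
proof -
  obtain S where S: "\<And>n. simple_process M W (S n)"
    "(\<lambda>n. \<integral>\<^sup>+ ((s, y), \<omega>). ennreal ((X s y \<omega> - simple_value (S n) s y \<omega>)\<^sup>2) \<partial>(slab t \<Otimes>\<^sub>M M)) \<longlonglongrightarrow> 0"
    "(\<lambda>n. \<integral>\<^sup>+ \<omega>. ennreal ((Y \<omega> - simple_walsh_integral W t (S n) \<omega>)\<^sup>2) \<partial>M) \<longlonglongrightarrow> 0"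
    using has_walsh_integralE[OF w] by blast
  obtain S' where S': "\<And>n. simple_process M W (S' n)"
    "(\<lambda>n. \<integral>\<^sup>+ ((s, y), \<omega>). ennreal ((X' s y \<omega> - simple_value (S' n) s y \<omega>)\<^sup>2) \<partial>(slab t \<Otimes>\<^sub>M M)) \<longlonglongrightarrow> 0"
    "(\<lambda>n. \<integral>\<^sup>+ \<omega>. ennreal ((Y' \<omega> - simple_walsh_integral W t (S' n) \<omega>)\<^sup>2) \<partial>M) \<longlonglongrightarrow> 0"
    using has_walsh_integralE[OF w'] by blast
  note m = has_walsh_integralD[OF w] has_walsh_integralD[OF w']
  have sq: "(\<lambda>n. \<integral>\<^sup>+ x. ennreal (((f n x + f' n x) :: real)\<^sup>2) \<partial>N) \<longlonglongrightarrow> 0"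
    if [measurable]: "\<And>n. f n \<in> borel_measurable N" "\<And>n. f' n \<in> borel_measurable N"
      and l: "(\<lambda>n. \<integral>\<^sup>+ x. ennreal ((f n x)\<^sup>2) \<partial>N) \<longlonglongrightarrow> 0" "(\<lambda>n. \<integral>\<^sup>+ x. ennreal ((f' n x)\<^sup>2) \<partial>N) \<longlonglongrightarrow> 0"
    for f f' :: "nat \<Rightarrow> 'c \<Rightarrow> real" and N
  proof (rule tendsto_sandwich[OF always_eventually always_eventually tendsto_const])
    show "(\<lambda>n. 2 * (\<integral>\<^sup>+ x. ennreal ((f n x)\<^sup>2) \<partial>N) + 2 * (\<integral>\<^sup>+ x. ennreal ((f' n x)\<^sup>2) \<partial>N)) \<longlonglongrightarrow> 0"
      using tendsto_add[OF ennreal_tendsto_cmult[OF _ l(1), of 2] ennreal_tendsto_cmult[OF _ l(2), of 2]] by simp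
    show "\<forall>n. (\<integral>\<^sup>+ x. ennreal ((f n x + f' n x)\<^sup>2) \<partial>N) \<le>
        2 * (\<integral>\<^sup>+ x. ennreal ((f n x)\<^sup>2) \<partial>N) + 2 * (\<integral>\<^sup>+ x. ennreal ((f' n x)\<^sup>2) \<partial>N)"
    proof
      fix n
      have "(\<integral>\<^sup>+ x. ennreal ((f n x + f' n x)\<^sup>2) \<partial>N) \<le> (\<integral>\<^sup>+ x. 2 * ennreal ((f n x)\<^sup>2) + 2 * ennreal ((f' n x)\<^sup>2) \<partial>N)"
      proof (rule nn_integral_mono)
        fix x
        have "ennreal ((f n x + f' n x)\<^sup>2) \<le> ennreal (2 * (f n x)\<^sup>2 + 2 * (f' n x)\<^sup>2)"
          by (intro ennreal_leI square_sum_le)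
        then show "ennreal ((f n x + f' n x)\<^sup>2) \<le> 2 * ennreal ((f n x)\<^sup>2) + 2 * ennreal ((f' n x)\<^sup>2)"
          by (simp add: ennreal_plus ennreal_mult')
      qed
      also have "\<dots> = 2 * (\<integral>\<^sup>+ x. ennreal ((f n x)\<^sup>2) \<partial>N) + 2 * (\<integral>\<^sup>+ x. ennreal ((f' n x)\<^sup>2) \<partial>N)"
        by (subst nn_integral_add) (auto simp: nn_integral_cmult)
      finally show "(\<integral>\<^sup>+ x. ennreal ((f n x + f' n x)\<^sup>2) \<partial>N) \<le> \<dots>" .
    qed
  qed simp
  have p: "simple_process M W (S n @ S' n)" for n by (rule simple_process_append[OF S(1) S'(1)])
  have mX: "(\<lambda>((s, y), \<omega>). X s y \<omega> + X' s y \<omega>) \<in> borel_measurable (slab t \<Otimes>\<^sub>M M)"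
    using m unfolding case_prod_beta' by measurable
  have md: "(\<lambda>((s, y), \<omega>). X s y \<omega> - simple_value (S n) s y \<omega>) \<in> borel_measurable (slab t \<Otimes>\<^sub>M M)"
    "(\<lambda>((s, y), \<omega>). X' s y \<omega> - simple_value (S' n) s y \<omega>) \<in> borel_measurable (slab t \<Otimes>\<^sub>M M)" for n
    using m simple_value_measurable[OF S(1)[of n], of t] simple_value_measurable[OF S'(1)[of n], of t]
    unfolding case_prod_beta' by measurable
  have mv: "(\<lambda>((s, y), \<omega>). X s y \<omega> + X' s y \<omega> - simple_value (S n @ S' n) s y \<omega>) \<in> borel_measurable (slab t \<Otimes>\<^sub>M M)" for n
    using mX simple_value_measurable[OF p[of n], of t] unfolding case_prod_beta' by measurable
  have "(\<lambda>n. \<integral>\<^sup>+ ((s, y), \<omega>). ennreal ((X s y \<omega> + X' s y \<omega> - simple_value (S n @ S' n) s y \<omega>)\<^sup>2) \<partial>(slab t \<Otimes>\<^sub>M M)) \<longlonglongrightarrow> 0"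
    using sq[of "\<lambda>n. \<lambda>((s, y), \<omega>). X s y \<omega> - simple_value (S n) s y \<omega>"
        "slab t \<Otimes>\<^sub>M M" "\<lambda>n. \<lambda>((s, y), \<omega>). X' s y \<omega> - simple_value (S' n) s y \<omega>", OF md]
      S(2) S'(2) by (simp add: case_prod_beta' simple_value_append algebra_simps)
  moreover have "(\<lambda>n. \<integral>\<^sup>+ \<omega>. ennreal ((Y \<omega> + Y' \<omega> - simple_walsh_integral W t (S n @ S' n) \<omega>)\<^sup>2) \<partial>M) \<longlonglongrightarrow> 0"
    using sq[of "\<lambda>n \<omega>. Y \<omega> - simple_walsh_integral W t (S n) \<omega>" M "\<lambda>n \<omega>. Y' \<omega> - simple_walsh_integral W t (S' n) \<omega>"]
      S(3) S'(3) m simple_walsh_integral_measurable[OF S(1)] simple_walsh_integral_measurable[OF S'(1)]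
    by (simp add: simple_walsh_integral_append algebra_simps)
  ultimately show ?thesis
    unfolding has_walsh_integral_def using mX m p iterated_L2_norm_sq[OF prob_space_axioms mv]
    by (auto simp: L2_norm_sq_def intro!: exI[of _ "\<lambda>n. S n @ S' n"])
qed

text \<open>Both squared norms are the limits of those of the approximations, which agree. The mean is the limit of zero means, because
  \<open>(E Z)\<^sup>2 \<le> E Z\<^sup>2\<close>.\<close>

lemma (in space_time_white_noise) walsh_isometry:
  assumes w: "has_walsh_integral M W t X Y"
    and fin: "integrable (slab t \<Otimes>\<^sub>M M) (\<lambda>((s, y), \<omega>). (X s y \<omega>)\<^sup>2)"
  shows "integrable M (\<lambda>\<omega>. (Y \<omega>)\<^sup>2)" "expectation Y = 0"
    "expectation (\<lambda>\<omega>. (Y \<omega>)\<^sup>2) = (\<integral>((s, y), \<omega>). (X s y \<omega>)\<^sup>2 \<partial>(slab t \<Otimes>\<^sub>M M))"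
proof -
  obtain S where S: "\<And>n. simple_process M W (S n)"
    and lX: "(\<lambda>n. \<integral>\<^sup>+ ((s, y), \<omega>). ennreal ((X s y \<omega> - simple_value (S n) s y \<omega>)\<^sup>2) \<partial>(slab t \<Otimes>\<^sub>M M)) \<longlonglongrightarrow> 0"
    and lY: "(\<lambda>n. \<integral>\<^sup>+ \<omega>. ennreal ((Y \<omega> - simple_walsh_integral W t (S n) \<omega>)\<^sup>2) \<partial>M) \<longlonglongrightarrow> 0"
    using has_walsh_integralE[OF w] by blast
  define J where "J n = simple_walsh_integral W t (S n)" for n
  note mX = has_walsh_integralD(1)[OF w]
  note [measurable] = has_walsh_integralD(2)[OF w]
  have [measurable]: "J n \<in> borel_measurable M" for n
    unfolding J_def by (rule simple_walsh_integral_measurable[OF S])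
  have J2: "integrable M (\<lambda>\<omega>. (J n \<omega>)\<^sup>2)"
    and iso: "expectation (\<lambda>\<omega>. (J n \<omega>)\<^sup>2) = (\<integral>((s, y), \<omega>). (simple_value (S n) s y \<omega>)\<^sup>2 \<partial>(slab t \<Otimes>\<^sub>M M))"
    for n
    using simple_walsh_isometry[OF S[of n], of t] by (auto simp: J_def has_bochner_integral_iff)
  have J1: "integrable M (J n)" "expectation (J n) = 0" for n
    using simple_walsh_integral_mean_zero[OF S[of n], of t] by (auto simp: J_def has_bochner_integral_iff)
  have sub2: "integrable M (\<lambda>\<omega>. (Y \<omega>)\<^sup>2) \<and> integrable M (\<lambda>\<omega>. (Y \<omega> - J n \<omega>)\<^sup>2)"
    if "(\<integral>\<^sup>+ \<omega>. ennreal ((Y \<omega> - J n \<omega>)\<^sup>2) \<partial>M) < \<infinity>" for n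
  proof -
    have d: "integrable M (\<lambda>\<omega>. (Y \<omega> - J n \<omega>)\<^sup>2)" using that by (subst integrable_square_iff) auto
    with integrable_square_add[of "\<lambda>\<omega>. Y \<omega> - J n \<omega>" M "J n"] J2 show ?thesis by simp
  qed
  have ev: "\<forall>\<^sub>F n in sequentially. (\<integral>\<^sup>+ \<omega>. ennreal ((Y \<omega> - J n \<omega>)\<^sup>2) \<partial>M) < \<infinity>"
    unfolding J_def by (rule order_tendstoD(2)[OF lY]) simp
  then show Y2: "integrable M (\<lambda>\<omega>. (Y \<omega>)\<^sup>2)"
    using sub2 by (auto dest: eventually_happens)
  have Y1: "integrable M Y"
    using integrable_product_of_squares[of Y M "\<lambda>_. 1"] Y2 by simp
  have "(\<lambda>n. expectation (\<lambda>\<omega>. (J n \<omega>)\<^sup>2)) \<longlonglongrightarrow> expectation (\<lambda>\<omega>. (Y \<omega>)\<^sup>2)"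
    using lY by (intro tendsto_integral_square[OF _ _ Y2]) (auto simp: J_def[symmetric])
  moreover have "(\<lambda>n. \<integral>((s, y), \<omega>). (simple_value (S n) s y \<omega>)\<^sup>2 \<partial>(slab t \<Otimes>\<^sub>M M)) \<longlonglongrightarrow>
      (\<integral>((s, y), \<omega>). (X s y \<omega>)\<^sup>2 \<partial>(slab t \<Otimes>\<^sub>M M))"
    using tendsto_integral_square[of "\<lambda>((s, y), \<omega>). X s y \<omega>" "slab t \<Otimes>\<^sub>M M"
        "\<lambda>n. \<lambda>((s, y), \<omega>). simple_value (S n) s y \<omega>" sequentially]
      mX simple_value_measurable[OF S] lX fin by (simp add: case_prod_beta')
  ultimately show "expectation (\<lambda>\<omega>. (Y \<omega>)\<^sup>2) = (\<integral>((s, y), \<omega>). (X s y \<omega>)\<^sup>2 \<partial>(slab t \<Otimes>\<^sub>M M))"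
    unfolding iso by (rule LIMSEQ_unique)
  have "\<forall>\<^sub>F n in sequentially. ennreal ((expectation Y)\<^sup>2) \<le> (\<integral>\<^sup>+ \<omega>. ennreal ((Y \<omega> - J n \<omega>)\<^sup>2) \<partial>M)"
    using ev
  proof eventually_elim
    case (elim n)
    have d: "integrable M (\<lambda>\<omega>. (Y \<omega> - J n \<omega>)\<^sup>2)" using sub2[OF elim] by simp
    have "(expectation Y)\<^sup>2 = (expectation (\<lambda>\<omega>. Y \<omega> - J n \<omega>))\<^sup>2" using Y1 J1 by simp
    also have "\<dots> \<le> expectation (\<lambda>\<omega>. (Y \<omega> - J n \<omega>)\<^sup>2)"
      using variance_eq[of "\<lambda>\<omega>. Y \<omega> - J n \<omega>"] variance_positive[of "\<lambda>\<omega>. Y \<omega> - J n \<omega>"] d Y1 J1(1)[of n] by simp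
    finally show ?case using nn_integral_eq_integral[OF d] by (simp add: ennreal_leI)
  qed
  then have "ennreal ((expectation Y)\<^sup>2) \<le> 0"
    using lY unfolding J_def[symmetric] by (intro tendsto_lowerbound) auto
  then show "expectation Y = 0" by simp
qed

text \<open>Polarisation of the isometry.\<close>

lemma (in space_time_white_noise) walsh_covariance:
  assumes w: "has_walsh_integral M W t X Y" and w': "has_walsh_integral M W t X' Y'"
    and fin: "integrable (slab t \<Otimes>\<^sub>M M) (\<lambda>((s, y), \<omega>). (X s y \<omega>)\<^sup>2)"
    and fin': "integrable (slab t \<Otimes>\<^sub>M M) (\<lambda>((s, y), \<omega>). (X' s y \<omega>)\<^sup>2)"
  shows "has_bochner_integral M (\<lambda>\<omega>. Y \<omega> * Y' \<omega>)
    (\<integral>((s, y), \<omega>). X s y \<omega> * X' s y \<omega> \<partial>(slab t \<Otimes>\<^sub>M M))"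
proof -
  let ?N = "slab t \<Otimes>\<^sub>M M"
  let ?X = "\<lambda>((s, y), \<omega>). X s y \<omega>" and ?X' = "\<lambda>((s, y), \<omega>). X' s y \<omega>"
  note m = has_walsh_integralD[OF w] has_walsh_integralD[OF w']
  have f: "integrable ?N (\<lambda>p. (?X p)\<^sup>2)" "integrable ?N (\<lambda>p. (?X' p)\<^sup>2)"
    using fin fin' by (simp_all add: case_prod_beta')
  have XX: "integrable ?N (\<lambda>p. ?X p * ?X' p)"
    by (rule integrable_product_of_squares[OF m(1,3) f])
  have YY: "integrable M (\<lambda>\<omega>. Y \<omega> * Y' \<omega>)"
    by (rule integrable_product_of_squares[OF m(2,4) walsh_isometry(1)[OF w fin] walsh_isometry(1)[OF w' fin']])
  have "integrable ?N (\<lambda>p. (?X p + ?X' p)\<^sup>2)"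
    by (rule integrable_square_add[OF m(1,3) f])
  then have fs: "integrable ?N (\<lambda>((s, y), \<omega>). (X s y \<omega> + X' s y \<omega>)\<^sup>2)"
    by (simp add: case_prod_beta')
  have "expectation (\<lambda>\<omega>. (Y \<omega> + Y' \<omega>)\<^sup>2) = (\<integral>p. (?X p + ?X' p)\<^sup>2 \<partial>?N)"
    using walsh_isometry(3)[OF has_walsh_integral_add[OF w w'] fs] by (simp add: case_prod_beta')
  moreover have "expectation (\<lambda>\<omega>. (Y \<omega> + Y' \<omega>)\<^sup>2) =
      expectation (\<lambda>\<omega>. (Y \<omega>)\<^sup>2) + expectation (\<lambda>\<omega>. (Y' \<omega>)\<^sup>2) + 2 * expectation (\<lambda>\<omega>. Y \<omega> * Y' \<omega>)"
    using walsh_isometry(1)[OF w fin] walsh_isometry(1)[OF w' fin'] YY by (simp add: power2_sum mult.assoc)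
  moreover have "(\<integral>p. (?X p + ?X' p)\<^sup>2 \<partial>?N) =
      (\<integral>p. (?X p)\<^sup>2 \<partial>?N) + (\<integral>p. (?X' p)\<^sup>2 \<partial>?N) + 2 * (\<integral>p. ?X p * ?X' p \<partial>?N)"
    using f XX by (simp add: power2_sum mult.assoc)
  moreover have "expectation (\<lambda>\<omega>. (Y \<omega>)\<^sup>2) = (\<integral>p. (?X p)\<^sup>2 \<partial>?N)" "expectation (\<lambda>\<omega>. (Y' \<omega>)\<^sup>2) = (\<integral>p. (?X' p)\<^sup>2 \<partial>?N)"
    using walsh_isometry(3)[OF w fin] walsh_isometry(3)[OF w' fin'] by (simp_all add: case_prod_beta')
  ultimately have "expectation (\<lambda>\<omega>. Y \<omega> * Y' \<omega>) = (\<integral>p. ?X p * ?X' p \<partial>?N)" by simp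
  then show ?thesis using YY by (simp add: has_bochner_integral_iff case_prod_beta')
qed

section \<open>Integrals over light cones and the deterministic equation\<close>

lemma T_kappa_bounds:
  assumes "\<kappa> > 0" "t \<ge> 0"
  shows "0 \<le> T_kappa \<kappa> t x" "T_kappa \<kappa> t x \<le> t"
  using assms by (auto simp: T_kappa_def indicator_def field_simps)

lemma T_kappa_zero: "\<kappa> > 0 \<Longrightarrow> t \<ge> 0 \<Longrightarrow> T_kappa \<kappa> t 0 = t"
  by (simp add: T_kappa_def)

lemma wave_kernel_cone:
  "wave_kernel \<kappa> (t - s) (x - z) = 1 / 2 * indicator {p. fst p \<le> t \<and> \<bar>x - snd p\<bar> \<le> \<kappa> * (t - fst p)} (s, z)"
  by (auto simp: wave_kernel_def indicator_def)

lemma wave_kernel_measurable [measurable]: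
  "(\<lambda>p. wave_kernel \<kappa> (t - fst p) (x - snd p)) \<in> borel_measurable (borel \<Otimes>\<^sub>M borel)"
  unfolding wave_kernel_cone prod.collapse by measurable

text \<open>At time \<open>s\<close> the two backward cones are intervals of radius \<open>\<kappa>(t - s)\<close> around \<open>x\<close> and \<open>y\<close>, which overlap in
  length \<open>2\<kappa>(t - s) - \<bar>x - y\<bar>\<close> if this is positive. When they do not meet at all, \<open>T\<^sub>\<kappa>\<close> is zero and
  the formula remains correct for \<open>s \<ge> 0\<close>.\<close>

lemma wave_kernel_slice:
  assumes "\<kappa> > 0" "0 \<le> s" "s \<le> t"
  shows "has_bochner_integral lborel (\<lambda>z. wave_kernel \<kappa> (t - s) (x - z) * wave_kernel \<kappa> (t - s) (y - z))
    (\<kappa> / 2 * max 0 (T_kappa \<kappa> t (x - y) - s))"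
proof -
  let ?l = "max x y - \<kappa> * (t - s)" and ?r = "min x y + \<kappa> * (t - s)"
  have "(\<lambda>z. wave_kernel \<kappa> (t - s) (x - z) * wave_kernel \<kappa> (t - s) (y - z)) =
      (\<lambda>z. 1 / 4 * indicator {?l..?r} z)"
    using assms by (auto simp: fun_eq_iff wave_kernel_def indicator_def)
  moreover have "has_bochner_integral lborel (\<lambda>z::real. indicator {?l..?r} z :: real) (max 0 (?r - ?l))"
    using has_bochner_integral_real_indicator[of "{?l..?r}" lborel]
    by (cases "?l \<le> ?r") (auto simp: emeasure_lborel_Icc_eq)
  moreover have "1 / 4 * max 0 (?r - ?l) = \<kappa> / 2 * max 0 (T_kappa \<kappa> t (x - y) - s)"
  proof -
    have rl: "?r - ?l = 2 * \<kappa> * (t - s) - \<bar>x - y\<bar>"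
      by (simp add: min_def max_def algebra_simps)
    show ?thesis
    proof (cases "\<bar>x - y\<bar> \<le> 2 * \<kappa> * t")
      case True
      then have "2 * \<kappa> * (T_kappa \<kappa> t (x - y) - s) = ?r - ?l"
        using assms unfolding rl by (simp add: T_kappa_def field_simps)
      then have "max 0 (?r - ?l) = 2 * \<kappa> * max 0 (T_kappa \<kappa> t (x - y) - s)"
        using assms by (metis max_mult_distrib_left mult_zero_right mult_pos_pos less_imp_le zero_less_numeral)
      then show ?thesis by simp
    next
      case False
      have "0 \<le> \<kappa> * s" using assms by simp
      then have "?r - ?l \<le> 0" using False unfolding rl by (simp add: algebra_simps)
      moreover have "T_kappa \<kappa> t (x - y) - s \<le> 0" using False assms by (simp add: T_kappa_def)
      ultimately show ?thesis by simp
    qed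
  qed
  ultimately show ?thesis
    using has_bochner_integral_mult_right[of "1/4" lborel "\<lambda>z. indicator {?l..?r} z" "max 0 (?r - ?l)"] by simp
qed

text \<open>After integration over space the integral is \<open>\<integral>\<^sub>0\<^sup>T (T - s) \<psi>''(s) ds\<close>, and \<open>(T - s) \<psi>'(s) + \<psi>(s)\<close> is an
  antiderivative of the integrand. This is Taylor's formula with integral remainder.\<close>

lemma has_bochner_integral_cone:
  assumes \<kappa>: "\<kappa> > 0" and t: "t \<ge> 0"
    and d1: "\<And>s. (\<psi> has_real_derivative \<psi>' s) (at s)"
    and d2: "\<And>s. (\<psi>' has_real_derivative \<kappa> / 2 * \<phi> s) (at s)"
    and c: "continuous_on UNIV \<phi>" and z: "\<psi> 0 = 0" "\<psi>' 0 = 0"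
  shows "has_bochner_integral (slab t)
    (\<lambda>(s, z). wave_kernel \<kappa> (t - s) (x - z) * wave_kernel \<kappa> (t - s) (y - z) * \<phi> s)
    (\<psi> (T_kappa \<kappa> t (x - y)))"
proof -
  define T where "T = T_kappa \<kappa> t (x - y)"
  note T = T_kappa_bounds[OF \<kappa> t, of "x - y", folded T_def]
  let ?K = "\<lambda>x s z. wave_kernel \<kappa> (t - s) (x - z)"
  let ?f = "\<lambda>(s, z). indicator {0..t} s * (?K x s z * ?K y s z * \<phi> s)"
  have [measurable]: "\<phi> \<in> borel_measurable borel" by (rule borel_measurable_continuous_onI[OF c])
  have "?f \<in> borel_measurable (borel \<Otimes>\<^sub>M borel)"
    unfolding case_prod_beta' by measurable
  then have m: "?f \<in> borel_measurable (lborel \<Otimes>\<^sub>M lborel)" by (simp add: lborel_prod borel_prod)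
  have sl: "has_bochner_integral lborel (\<lambda>z. ?f (s, z)) (indicator {0..T} s * (\<kappa> / 2 * (T - s) * \<phi> s))" for s
  proof (cases "0 \<le> s \<and> s \<le> t")
    case True
    have eq: "indicator {0..T} s * (\<kappa> / 2 * (T - s) * \<phi> s) = \<kappa> / 2 * max 0 (T - s) * \<phi> s"
      using True by (auto simp: indicator_def)
    show ?thesis
      unfolding eq using has_bochner_integral_mult_left[OF wave_kernel_slice[OF \<kappa>, of s t x y], of "\<phi> s"] True
      by (simp add: T_def)
  next
    case False
    then show ?thesis using T by (auto simp: indicator_def)
  qed
  have nsl: "(\<integral>z. norm (?f (s, z)) \<partial>lborel) = indicator {0..T} s *\<^sub>R norm (\<kappa> / 2 * (T - s) * \<phi> s)" for s
  proof -
    \<comment> \<open>The kernels are non-negative, so the sign of the integrand is constant on each time slice.\<close>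
    have "norm (?f (s, z)) = ?f (s, z) * sgn (\<phi> s)" for z
      by (auto simp: abs_mult wave_kernel_def indicator_def abs_sgn)
    then have "(\<integral>z. norm (?f (s, z)) \<partial>lborel) = (indicator {0..T} s * (\<kappa> / 2 * (T - s) * \<phi> s)) * sgn (\<phi> s)"
      using has_bochner_integral_mult_left[OF sl[of s], of "sgn (\<phi> s)"] by (simp add: has_bochner_integral_iff)
    also have "\<dots> = indicator {0..T} s *\<^sub>R norm (\<kappa> / 2 * (T - s) * \<phi> s)"
      using \<kappa> by (auto simp: indicator_def abs_mult sgn_if)
    finally show ?thesis .
  qed
  have int: "integrable (lborel \<Otimes>\<^sub>M lborel) ?f"
  proof (rule lborel_pair.Fubini_integrable[OF m])
    have "integrable lborel (\<lambda>s. indicator {0..T} s *\<^sub>R norm (\<kappa> / 2 * (T - s) * \<phi> s))"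
      by (rule borel_integrable_compact) (auto intro!: continuous_intros continuous_on_subset[OF c])
    then show "integrable lborel (\<lambda>s. \<integral>z. norm (?f (s, z)) \<partial>lborel)" unfolding nsl .
    show "AE s in lborel. integrable lborel (\<lambda>z. ?f (s, z))"
      using sl by (auto simp: has_bochner_integral_iff)
  qed
  have "integral\<^sup>L (lborel \<Otimes>\<^sub>M lborel) ?f = (\<integral>s. \<integral>z. ?f (s, z) \<partial>lborel \<partial>lborel)"
    by (rule lborel_pair.integral_fst'[OF int, symmetric])
  also have "\<dots> = (\<integral>s. (\<kappa> / 2 * (T - s) * \<phi> s) * indicator {0..T} s \<partial>lborel)"
    using has_bochner_integral_integral_eq[OF sl] by (simp only: mult.commute[of "indicator {0..T} _"])
  also have "\<dots> = ((T - T) * \<psi>' T + \<psi> T) - ((T - 0) * \<psi>' 0 + \<psi> 0)"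
  proof (rule integral_FTC_Icc_real[OF T(1)])
    fix s
    show "((\<lambda>s. (T - s) * \<psi>' s + \<psi> s) has_real_derivative \<kappa> / 2 * (T - s) * \<phi> s) (at s)"
      by (auto intro!: derivative_eq_intros d1 d2)
    show "isCont (\<lambda>s. \<kappa> / 2 * (T - s) * \<phi> s) s"
      using c by (auto intro!: continuous_intros simp: continuous_on_eq_continuous_at)
  qed
  finally have "has_bochner_integral lborel ?f (\<psi> T)"
    using int z by (simp add: has_bochner_integral_iff lborel_prod)
  moreover have "?f = (\<lambda>p. indicator ({0..t} \<times> UNIV) p *\<^sub>R
      (case p of (s, z) \<Rightarrow> ?K x s z * ?K y s z * \<phi> s))"
    by (auto simp: fun_eq_iff indicator_def)
  moreover have "({0..t} \<times> UNIV) \<inter> space lborel \<in> sets (lborel :: (real \<times> real) measure)"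
    by (simp add: borel_Times)
  ultimately show ?thesis
    unfolding T_def[symmetric] slab_def has_bochner_integral_iff
    by (simp add: integrable_restrict_space integral_restrict_space)
qed

text \<open>The closed form depends on time only: constant initial data and the homogeneous noise make the law of
  the solution invariant under translations in space.\<close>

definition wave_second_moment :: "real \<Rightarrow> real \<Rightarrow> real \<Rightarrow> real \<Rightarrow> real \<Rightarrow> real \<Rightarrow> real" where
  "wave_second_moment \<kappa> l \<sigma> w w' t =
     w\<^sup>2 + (w\<^sup>2 + \<sigma>\<^sup>2 + 4 * \<kappa> * w'\<^sup>2 / l\<^sup>2) * H_fun \<kappa> l t
       + 2 * sqrt (2 * \<kappa>) * w * w' / \<bar>l\<bar> * sinh (sqrt \<kappa> * \<bar>l\<bar> * t / sqrt 2)"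

text \<open>The function \<open>\<psi>(s) = h(s) - (w + \<kappa>w's)\<^sup>2\<close>, with \<open>h\<close> the closed form, satisfies
  \<open>\<psi>'' = (\<kappa>/2) \<lambda>\<^sup>2 (\<varsigma>\<^sup>2 + h)\<close> and vanishes to first order at \<open>0\<close>. For \<open>x = y\<close> this says that \<open>h\<close>
  solves the integral equation of the second moment.\<close>

lemma wave_second_moment_cone:
  assumes \<kappa>: "\<kappa> > 0" and l: "l \<noteq> 0" and t: "t \<ge> 0"
  shows "has_bochner_integral (slab t)
    (\<lambda>(s, z). wave_kernel \<kappa> (t - s) (x - z) * wave_kernel \<kappa> (t - s) (y - z) *
      (l\<^sup>2 * (\<sigma>\<^sup>2 + wave_second_moment \<kappa> l \<sigma> w w' s)))
    (wave_second_moment \<kappa> l \<sigma> w w' (T_kappa \<kappa> t (x - y)) - (w + \<kappa> * w' * T_kappa \<kappa> t (x - y))\<^sup>2)"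
proof -
  \<comment> \<open>With these abbreviations the closed form is \<open>w\<^sup>2 + A (cosh (cs) - 1) + B sinh (cs)\<close>; \<open>c\<^sup>2\<close> is the rate of
    the differential equation, and \<open>Bc\<close> is the initial velocity of the second moment.\<close>
  define c where "c = \<bar>l\<bar> * sqrt (\<kappa> / 2)"
  define A where "A = w\<^sup>2 + \<sigma>\<^sup>2 + 4 * \<kappa> * w'\<^sup>2 / l\<^sup>2"
  define B where "B = 2 * sqrt (2 * \<kappa>) * w * w' / \<bar>l\<bar>"
  have "c\<^sup>2 = l\<^sup>2 * \<kappa> / 2" using \<kappa> by (simp add: c_def power_mult_distrib)
  then have c2: "c * c = l\<^sup>2 * \<kappa> / 2" by (simp only: power2_eq_square[of c])
  have ss: "sqrt (2 * \<kappa>) * sqrt (\<kappa> / 2) = \<kappa>"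
    using \<kappa> real_sqrt_mult[of "2 * \<kappa>" "\<kappa> / 2"] by simp
  have "B * c = 2 * w * w' * (sqrt (2 * \<kappa>) * sqrt (\<kappa> / 2))" using l by (simp add: B_def c_def)
  then have Bc: "B * c = 2 * \<kappa> * w * w'" by (simp add: ss)
  have Ac: "A * (c * c) = l\<^sup>2 * \<kappa> / 2 * (w\<^sup>2 + \<sigma>\<^sup>2) + 2 * \<kappa>\<^sup>2 * w'\<^sup>2"
    using l by (simp add: c2 A_def field_simps power2_eq_square)
  have h: "wave_second_moment \<kappa> l \<sigma> w w' s = w\<^sup>2 + A * (cosh (c * s) - 1) + B * sinh (c * s)" for s
    by (simp add: wave_second_moment_def H_fun_def A_def B_def c_def real_sqrt_divide mult_ac)
  define \<psi> where "\<psi> s = w\<^sup>2 + A * (cosh (c * s) - 1) + B * sinh (c * s) - (w + \<kappa> * w' * s)\<^sup>2" for s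
  define \<psi>' where "\<psi>' s = A * c * sinh (c * s) + B * c * cosh (c * s) - 2 * \<kappa> * w' * (w + \<kappa> * w' * s)" for s
  have "has_bochner_integral (slab t)
    (\<lambda>(s, z). wave_kernel \<kappa> (t - s) (x - z) * wave_kernel \<kappa> (t - s) (y - z) *
      (l\<^sup>2 * (\<sigma>\<^sup>2 + (w\<^sup>2 + A * (cosh (c * s) - 1) + B * sinh (c * s)))))
    (\<psi> (T_kappa \<kappa> t (x - y)))"
  proof (rule has_bochner_integral_cone[OF \<kappa> t, where \<psi>' = \<psi>'])
    fix s
    show "(\<psi> has_real_derivative \<psi>' s) (at s)"
      unfolding \<psi>_def \<psi>'_def
      by (auto intro!: derivative_eq_intros simp: algebra_simps)
    have eq: "A * c * (cosh (c * s) * c) + B * c * (sinh (c * s) * c) - 2 * \<kappa> * w' * (\<kappa> * w') =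
        \<kappa> / 2 * (l\<^sup>2 * (\<sigma>\<^sup>2 + (w\<^sup>2 + A * (cosh (c * s) - 1) + B * sinh (c * s))))"
    proof -
      have "A * c * (cosh (c * s) * c) + B * c * (sinh (c * s) * c) - 2 * \<kappa> * w' * (\<kappa> * w') =
          (c * c) * (A * (cosh (c * s) - 1) + B * sinh (c * s)) + A * (c * c) - 2 * \<kappa>\<^sup>2 * w'\<^sup>2"
        by (simp add: algebra_simps power2_eq_square)
      also have "\<dots> = \<kappa> / 2 * (l\<^sup>2 * (\<sigma>\<^sup>2 + (w\<^sup>2 + A * (cosh (c * s) - 1) + B * sinh (c * s))))"
        unfolding Ac unfolding c2 by (simp add: algebra_simps)
      finally show ?thesis .
    qed
    show "(\<psi>' has_real_derivative \<kappa> / 2 * (l\<^sup>2 * (\<sigma>\<^sup>2 + (w\<^sup>2 + A * (cosh (c * s) - 1) + B * sinh (c * s))))) (at s)"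
      unfolding \<psi>'_def eq[symmetric] by (auto intro!: derivative_eq_intros)
  next
    show "continuous_on UNIV (\<lambda>s. l\<^sup>2 * (\<sigma>\<^sup>2 + (w\<^sup>2 + A * (cosh (c * s) - 1) + B * sinh (c * s))))"
      by (intro continuous_intros)
    show "\<psi> 0 = 0" by (simp add: \<psi>_def)
    show "\<psi>' 0 = 0" by (simp add: \<psi>'_def Bc)
  qed
  then show ?thesis by (simp add: h \<psi>_def)
qed

text \<open>The backward cone of \<open>(t0, x0)\<close> contains the backward cones of all its points, so the inequality can be
  iterated inside it. With \<open>\<beta>\<^sup>2 = \<kappa>C\<close> each application to a bound of the form \<open>b exp(\<beta>t)\<close> halves the constant \<open>b\<close>,
  since \<open>\<psi>(s) = (b/2) (exp(\<beta>s) - 1 - \<beta>s)\<close> has \<open>\<psi>'' = (\<kappa>/2) C b exp(\<beta>s)\<close>.\<close>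

lemma cone_inequality_unique:
  fixes d :: "real \<Rightarrow> real \<Rightarrow> real"
  assumes \<kappa>: "\<kappa> > 0" and C: "C > 0"
    and bd: "\<And>t0 x0. t0 \<ge> 0 \<Longrightarrow> \<exists>B. \<forall>t x. 0 \<le> t \<longrightarrow> t \<le> t0 \<longrightarrow> \<bar>x - x0\<bar> \<le> \<kappa> * (t0 - t) \<longrightarrow> \<bar>d t x\<bar> \<le> B"
    and ineq: "\<And>t x. t \<ge> 0 \<Longrightarrow> ennreal \<bar>d t x\<bar> \<le>
      (\<integral>\<^sup>+(s, z). ennreal ((wave_kernel \<kappa> (t - s) (x - z))\<^sup>2 * (C * \<bar>d s z\<bar>)) \<partial>slab t)"
    and t0: "t0 \<ge> 0"
  shows "d t0 x0 = 0"
proof -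
  define \<beta> where "\<beta> = sqrt (\<kappa> * C)"
  have \<beta>: "\<beta> > 0" "\<beta> * \<beta> = \<kappa> * C" using \<kappa> C by (auto simp: \<beta>_def)
  obtain B where "\<forall>t x. 0 \<le> t \<longrightarrow> t \<le> t0 \<longrightarrow> \<bar>x - x0\<bar> \<le> \<kappa> * (t0 - t) \<longrightarrow> \<bar>d t x\<bar> \<le> B"
    using bd[OF t0] by blast
  then have B: "\<bar>d t x\<bar> \<le> B" if "0 \<le> t" "t \<le> t0" "\<bar>x - x0\<bar> \<le> \<kappa> * (t0 - t)" for t x
    using that by blast
  have B0: "B \<ge> 0" using B[of t0 x0] t0 by simp
  have bound: "\<bar>d t x\<bar> \<le> B * (1 / 2) ^ n * exp (\<beta> * t)"
    if "0 \<le> t" "t \<le> t0" "\<bar>x - x0\<bar> \<le> \<kappa> * (t0 - t)" for t x n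
    using that
  proof (induction n arbitrary: t x)
    case 0
    have "\<bar>d t x\<bar> \<le> B * 1" using B[OF 0] by simp
    also have "\<dots> \<le> B * exp (\<beta> * t)" using 0 \<beta> B0 by (intro mult_left_mono) auto
    finally show ?case by simp
  next
    case (Suc n)
    define b where "b = B * (1 / 2) ^ n"
    have b0: "b \<ge> 0" using B0 by (simp add: b_def)
    define \<psi> where "\<psi> s = b / 2 * (exp (\<beta> * s) - 1 - \<beta> * s)" for s
    define \<psi>' where "\<psi>' s = b / 2 * (\<beta> * exp (\<beta> * s) - \<beta>)" for s
    have hbi: "has_bochner_integral (slab t)
      (\<lambda>(s, z). wave_kernel \<kappa> (t - s) (x - z) * wave_kernel \<kappa> (t - s) (x - z) * (C * (b * exp (\<beta> * s))))
      (\<psi> (T_kappa \<kappa> t (x - x)))"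
    proof (rule has_bochner_integral_cone[OF \<kappa> Suc.prems(1), where \<psi>' = \<psi>'])
      fix s
      show "(\<psi> has_real_derivative \<psi>' s) (at s)"
        unfolding \<psi>_def \<psi>'_def by (auto intro!: derivative_eq_intros simp: field_simps)
      have eq: "\<kappa> / 2 * (C * (b * exp (\<beta> * s))) = b / 2 * (\<beta> * (exp (\<beta> * s) * \<beta>))"
      proof -
        have "b / 2 * (\<beta> * (exp (\<beta> * s) * \<beta>)) = b / 2 * ((\<beta> * \<beta>) * exp (\<beta> * s))" by (simp only: mult_ac)
        then show ?thesis unfolding \<beta>(2) by (simp only: mult_ac times_divide_eq_left times_divide_eq_right)
      qed
      show "(\<psi>' has_real_derivative \<kappa> / 2 * (C * (b * exp (\<beta> * s)))) (at s)"
        unfolding eq \<psi>'_def by (auto intro!: derivative_eq_intros)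
    next
      show "continuous_on UNIV (\<lambda>s. C * (b * exp (\<beta> * s)))" by (intro continuous_intros)
    qed (simp_all add: \<psi>_def \<psi>'_def)
    have "ennreal \<bar>d t x\<bar> \<le> (\<integral>\<^sup>+(s, z). ennreal ((wave_kernel \<kappa> (t - s) (x - z))\<^sup>2 * (C * \<bar>d s z\<bar>)) \<partial>slab t)"
      by (rule ineq[OF Suc.prems(1)])
    also have "\<dots> \<le> (\<integral>\<^sup>+(s, z). ennreal (wave_kernel \<kappa> (t - s) (x - z) * wave_kernel \<kappa> (t - s) (x - z) *
        (C * (b * exp (\<beta> * s)))) \<partial>slab t)"
    proof (intro nn_integral_mono, clarify)
      fix s z assume "(s, z) \<in> space (slab t)"
      then have s: "0 \<le> s" "s \<le> t" by (auto simp: slab_def space_restrict_space)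
      show "ennreal ((wave_kernel \<kappa> (t - s) (x - z))\<^sup>2 * (C * \<bar>d s z\<bar>))
         \<le> ennreal (wave_kernel \<kappa> (t - s) (x - z) * wave_kernel \<kappa> (t - s) (x - z) * (C * (b * exp (\<beta> * s))))"
      proof (cases "wave_kernel \<kappa> (t - s) (x - z) = 0")
        case False
        then have "\<bar>x - z\<bar> \<le> \<kappa> * (t - s)"
          by (auto simp: wave_kernel_cone indicator_def split: if_splits)
        then have "\<bar>z - x0\<bar> \<le> \<kappa> * (t0 - s)"
          using Suc.prems(3) by (simp add: algebra_simps)
        then have "\<bar>d s z\<bar> \<le> b * exp (\<beta> * s)" using s Suc.prems unfolding b_def by (intro Suc.IH) auto
        then show ?thesis
          using C by (intro ennreal_leI) (simp add: power2_eq_square mult_left_mono)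
      qed simp
    qed
    also have "\<dots> = ennreal (\<psi> (T_kappa \<kappa> t (x - x)))"
    proof -
      let ?g = "\<lambda>(s, z). wave_kernel \<kappa> (t - s) (x - z) * wave_kernel \<kappa> (t - s) (x - z) * (C * (b * exp (\<beta> * s)))"
      have "(\<integral>\<^sup>+p. ennreal (?g p) \<partial>slab t) = ennreal (\<integral>p. ?g p \<partial>slab t)"
        using hbi C b0 by (intro nn_integral_eq_integral) (auto simp: has_bochner_integral_iff)
      then show ?thesis using has_bochner_integral_integral_eq[OF hbi] by (simp add: case_prod_beta')
    qed
    also have "\<dots> = ennreal (\<psi> t)" using T_kappa_zero[OF \<kappa> Suc.prems(1)] by simp
    finally have "\<bar>d t x\<bar> \<le> max 0 (\<psi> t)" by (cases "\<psi> t \<ge> 0") (auto simp: ennreal_neg)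
    also have "\<dots> \<le> b / 2 * exp (\<beta> * t)"
    proof (rule max.boundedI)
      have "0 \<le> \<beta> * t" using \<beta> Suc.prems(1) by simp
      then show "\<psi> t \<le> b / 2 * exp (\<beta> * t)"
        unfolding \<psi>_def using b0 by (intro mult_left_mono) auto
    qed (use b0 in simp)
    finally show ?case by (simp add: b_def)
  qed
  have "(\<lambda>n. B * (1 / 2) ^ n * exp (\<beta> * t0)) \<longlonglongrightarrow> B * 0 * exp (\<beta> * t0)"
    by (intro tendsto_intros LIMSEQ_power_zero) simp
  then have "\<bar>d t0 x0\<bar> \<le> B * 0 * exp (\<beta> * t0)"
  proof (rule LIMSEQ_le_const)
    show "\<exists>N. \<forall>n\<ge>N. \<bar>d t0 x0\<bar> \<le> B * (1 / 2) ^ n * exp (\<beta> * t0)"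
      using bound[of t0 x0] t0 by simp
  qed
  then show ?thesis by simp
qed

section \<open>Second moments of the solution\<close>

lemma wave_J0_constant:
  assumes "\<kappa> > 0" "t \<ge> 0"
  shows "wave_J0 \<kappa> (\<lambda>_. w) (\<lambda>_. w') t x = w + \<kappa> * w' * t"
proof -
  have "(\<lambda>y. wave_kernel \<kappa> t (x - y) * w') = (\<lambda>y. indicator {x - \<kappa> * t..x + \<kappa> * t} y * (w' / 2))"
    using assms by (auto simp: fun_eq_iff wave_kernel_def indicator_def)
  moreover have "(\<integral>y. indicator {x - \<kappa> * t..x + \<kappa> * t} y * (w' / 2) \<partial>lborel) = \<kappa> * w' * t"
    using assms by simp
  ultimately show ?thesis by (simp add: wave_J0_def)
qed

text \<open>The integrability assumed of a solution concerns positive times; at time zero the domain of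
  integration is a null set.\<close>

lemma nn_integral_slab_zero: "(\<integral>\<^sup>+p. f p \<partial>slab 0) = 0"
proof -
  have "emeasure (slab 0) (space (slab 0)) = emeasure lborel ({0..0::real} \<times> (UNIV :: real set))"
    using emeasure_slab[of UNIV 0] by simp
  also have "\<dots> = 0" by (subst emeasure_rectangle) auto
  finally have "space (slab 0) \<in> null_sets (slab 0)" by (intro null_setsI sets.top)
  then have "AE p in slab 0. f p = 0" by (rule AE_I') auto
  then show ?thesis by (subst nn_integral_cong_AE[where v = "\<lambda>_. 0"]) auto
qed

text \<open>The isometry is applied to \<open>I = u - J\<^sub>0\<close>. The identity for \<open>\<rho>\<^sup>2\<close> makes the inner integral over \<open>\<Omega>\<close> an
  affine function of the second moment, which closes the system.\<close>

lemma (in space_time_white_noise) wave_solution_second_moments: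
  assumes \<kappa>: "\<kappa> > 0" and sol: "wave_solution M W \<kappa> \<rho> (\<lambda>_. w) (\<lambda>_. w') u"
    and \<rho>: "\<And>x. (\<rho> x)\<^sup>2 = l\<^sup>2 * (\<sigma>\<^sup>2 + x\<^sup>2)" and \<rho>c: "\<rho> \<in> borel_measurable borel"
  shows wave_solution_L2: "\<And>t x. t \<ge> 0 \<Longrightarrow> integrable M (\<lambda>\<omega>. (u t x \<omega>)\<^sup>2)"
    and wave_solution_covariance: "\<And>t x y. t \<ge> 0 \<Longrightarrow> has_bochner_integral M (\<lambda>\<omega>. u t x \<omega> * u t y \<omega>)
      ((w + \<kappa> * w' * t)\<^sup>2 + (\<integral>(s, z). wave_kernel \<kappa> (t - s) (x - z) * wave_kernel \<kappa> (t - s) (y - z) *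
        (l\<^sup>2 * (\<sigma>\<^sup>2 + expectation (\<lambda>\<omega>. (u s z \<omega>)\<^sup>2))) \<partial>slab t))"
    and wave_solution_cone_integrable: "\<And>t x y. t \<ge> 0 \<Longrightarrow> integrable (slab t) (\<lambda>(s, z).
        wave_kernel \<kappa> (t - s) (x - z) * wave_kernel \<kappa> (t - s) (y - z) *
        (l\<^sup>2 * (\<sigma>\<^sup>2 + expectation (\<lambda>\<omega>. (u s z \<omega>)\<^sup>2))))"
    and wave_solution_moment_continuous:
      "continuous_on ({0..} \<times> UNIV) (\<lambda>(t, x). expectation (\<lambda>\<omega>. (u t x \<omega>)\<^sup>2))"
proof -
  note S = sol[unfolded wave_solution_def]
  note S2 = S[THEN conjunct2, THEN conjunct2]
  from S2[THEN conjunct2] obtain I where I: "\<forall>t\<ge>0. \<forall>x. has_walsh_integral M W t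
            (\<lambda>s y \<omega>. wave_kernel \<kappa> (t - s) (x - y) * \<rho> (u s y \<omega>)) (I t x)"
      "\<forall>t\<ge>0. \<forall>x. ((\<lambda>(t', x'). L2_norm_sq M (\<lambda>\<omega>. I t' x' \<omega> - I t x \<omega>)) \<longlongrightarrow> 0)
            (at (t, x) within {0..} \<times> UNIV)"
      "\<forall>t\<ge>0. \<forall>x. AE \<omega> in M. u t x \<omega> = wave_J0 \<kappa> (\<lambda>_. w) (\<lambda>_. w') t x + I t x \<omega>"
    by (elim exE conjE)
  have wI: "has_walsh_integral M W t (\<lambda>s y \<omega>. wave_kernel \<kappa> (t - s) (x - y) * \<rho> (u s y \<omega>)) (I t x)"
    if "t \<ge> 0" for t x
    using I(1)[THEN spec, THEN mp, OF that] by (rule spec)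
  have cI: "((\<lambda>(t', x'). L2_norm_sq M (\<lambda>\<omega>. I t' x' \<omega> - I t x \<omega>)) \<longlongrightarrow> 0) (at (t, x) within {0..} \<times> UNIV)"
    if "t \<ge> 0" for t x
    using I(2)[THEN spec, THEN mp, OF that] by (rule spec)
  have uI: "AE \<omega> in M. u t x \<omega> = wave_J0 \<kappa> (\<lambda>_. w) (\<lambda>_. w') t x + I t x \<omega>" if "t \<ge> 0" for t x
    using I(3)[THEN spec, THEN mp, OF that] by (rule spec)
  have um: "u t x \<in> borel_measurable M" if "t \<ge> 0" for t x
    using S[THEN conjunct1, THEN spec, THEN mp, OF that] by (intro measurable_from_filtration) (rule spec)
  have fin: "(\<integral>\<^sup>+ (s, y). ennreal ((wave_kernel \<kappa> (t - s) (x - y))\<^sup>2) * L2_norm_sq M (\<lambda>\<omega>. \<rho> (u s y \<omega>)) \<partial>slab t) < \<infinity>"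
    if "t > 0" for t x
    using S2[THEN conjunct1, THEN spec, THEN mp, OF that] by (rule spec)
  let ?K = "\<lambda>t x s y. wave_kernel \<kappa> (t - s) (x - y)"
  let ?X = "\<lambda>t x s y \<omega>. ?K t x s y * \<rho> (u s y \<omega>)"
  have mX: "(\<lambda>((s, y), \<omega>). ?X t x s y \<omega>) \<in> borel_measurable (slab t \<Otimes>\<^sub>M M)" if "t \<ge> 0" for t x
    by (rule has_walsh_integralD(1)[OF wI[OF that]])
  have X2: "integrable (slab t \<Otimes>\<^sub>M M) (\<lambda>((s, y), \<omega>). (?X t x s y \<omega>)\<^sup>2)" if t: "t \<ge> 0" for t x
  proof -
    have L: "L2_norm_sq M (?X t x s y) = ennreal ((?K t x s y)\<^sup>2) * L2_norm_sq M (\<lambda>\<omega>. \<rho> (u s y \<omega>))"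
      if "s \<ge> 0" for s y
    proof -
      note [measurable] = um[OF that] \<rho>c
      have "(\<lambda>\<omega>. ennreal ((\<rho> (u s y \<omega>))\<^sup>2)) \<in> borel_measurable M" by measurable
      from nn_integral_cmult[OF this, of "ennreal ((?K t x s y)\<^sup>2)"]
      show ?thesis by (simp add: L2_norm_sq_def power_mult_distrib ennreal_mult')
    qed
    have "(\<integral>\<^sup>+((s, y), \<omega>). ennreal ((?X t x s y \<omega>)\<^sup>2) \<partial>(slab t \<Otimes>\<^sub>M M)) =
        (\<integral>\<^sup>+(s, y). L2_norm_sq M (?X t x s y) \<partial>slab t)"
      by (rule iterated_L2_norm_sq[OF prob_space_axioms mX[OF t], symmetric])
    also have "\<dots> = (\<integral>\<^sup>+(s, y). ennreal ((?K t x s y)\<^sup>2) * L2_norm_sq M (\<lambda>\<omega>. \<rho> (u s y \<omega>)) \<partial>slab t)"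
      by (rule nn_integral_cong) (auto simp: L)
    also have "\<dots> < \<infinity>"
      using fin[of t x] t by (cases "t = 0") (auto simp: nn_integral_slab_zero)
    finally show ?thesis
      using integrable_square_iff[OF mX[OF t, of x]] by (simp add: case_prod_beta')
  qed
  note I2 = walsh_isometry(1)[OF wI X2] and I0 = walsh_isometry(2)[OF wI X2]
  have Im: "I t x \<in> borel_measurable M" if "t \<ge> 0" for t x
    by (rule has_walsh_integralD(2)[OF wI[OF that]])
  have I1: "integrable M (I t x)" if "t \<ge> 0" for t x
    using integrable_product_of_squares[OF Im[OF that, of x], of "\<lambda>_. 1"] I2[OF that that] by simp
  have uJ: "AE \<omega> in M. u t x \<omega> = w + \<kappa> * w' * t + I t x \<omega>" if "t \<ge> 0" for t x
    using uI[OF that, of x] by (simp add: wave_J0_constant[OF \<kappa> that])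
  have cov: "has_bochner_integral M (\<lambda>\<omega>. u t x \<omega> * u t y \<omega>)
      ((w + \<kappa> * w' * t)\<^sup>2 + expectation (\<lambda>\<omega>. I t x \<omega> * I t y \<omega>))"
    and II: "expectation (\<lambda>\<omega>. I t x \<omega> * I t y \<omega>) = (\<integral>((s, z), \<omega>). ?X t x s z \<omega> * ?X t y s z \<omega> \<partial>(slab t \<Otimes>\<^sub>M M))"
    if t: "t \<ge> 0" for t x y
  proof -
    let ?j = "w + \<kappa> * w' * t"
    have II': "has_bochner_integral M (\<lambda>\<omega>. I t x \<omega> * I t y \<omega>)
        (\<integral>((s, z), \<omega>). ?X t x s z \<omega> * ?X t y s z \<omega> \<partial>(slab t \<Otimes>\<^sub>M M))"
      by (rule walsh_covariance[OF wI[OF t] wI[OF t] X2[OF t] X2[OF t]])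
    then show "expectation (\<lambda>\<omega>. I t x \<omega> * I t y \<omega>) = (\<integral>((s, z), \<omega>). ?X t x s z \<omega> * ?X t y s z \<omega> \<partial>(slab t \<Otimes>\<^sub>M M))"
      by (rule has_bochner_integral_integral_eq)
    have "has_bochner_integral M (\<lambda>\<omega>. ?j\<^sup>2 + (?j * I t x \<omega> + (?j * I t y \<omega> + I t x \<omega> * I t y \<omega>)))
       (?j\<^sup>2 + (?j * 0 + (?j * 0 + expectation (\<lambda>\<omega>. I t x \<omega> * I t y \<omega>))))"
      using II' I1[OF t] I0[OF t t] by (intro has_bochner_integral_add has_bochner_integral_mult_right)
        (auto simp: has_bochner_integral_iff prob_space)
    moreover have "AE \<omega> in M. ?j\<^sup>2 + (?j * I t x \<omega> + (?j * I t y \<omega> + I t x \<omega> * I t y \<omega>)) = u t x \<omega> * u t y \<omega>"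
      using uJ[OF t, of x] uJ[OF t, of y] by eventually_elim (simp add: power2_eq_square algebra_simps)
    ultimately show "has_bochner_integral M (\<lambda>\<omega>. u t x \<omega> * u t y \<omega>)
      (?j\<^sup>2 + expectation (\<lambda>\<omega>. I t x \<omega> * I t y \<omega>))"
      using um[OF t, of x] um[OF t, of y] by (auto intro: has_bochner_integralI_AE)
  qed
  show u2: "integrable M (\<lambda>\<omega>. (u t x \<omega>)\<^sup>2)" if "t \<ge> 0" for t x
    using cov[OF that, of x x] by (simp add: has_bochner_integral_iff power2_eq_square)
  have cone: "integrable (slab t) (\<lambda>(s, z). ?K t x s z * ?K t y s z * (l\<^sup>2 * (\<sigma>\<^sup>2 + expectation (\<lambda>\<omega>. (u s z \<omega>)\<^sup>2)))) \<and>
    (\<integral>((s, z), \<omega>). ?X t x s z \<omega> * ?X t y s z \<omega> \<partial>(slab t \<Otimes>\<^sub>M M)) =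
    (\<integral>(s, z). ?K t x s z * ?K t y s z * (l\<^sup>2 * (\<sigma>\<^sup>2 + expectation (\<lambda>\<omega>. (u s z \<omega>)\<^sup>2))) \<partial>slab t)"
    if t: "t \<ge> 0" for t x y
  proof -
    interpret slab: sigma_finite_measure "slab t" by (rule sigma_finite_slab)
    interpret P: pair_sigma_finite "slab t" M ..
    let ?F = "\<lambda>((s, z), \<omega>). ?X t x s z \<omega> * ?X t y s z \<omega>"
    have "integrable (slab t \<Otimes>\<^sub>M M) (\<lambda>p. ((\<lambda>((s, z), \<omega>). ?X t x s z \<omega>) p)\<^sup>2)" for x
      using X2[OF t, of x] by (simp add: case_prod_beta')
    from integrable_product_of_squares[OF mX[OF t] mX[OF t] this this]
    have int: "integrable (slab t \<Otimes>\<^sub>M M) ?F" by (simp add: case_prod_beta')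
    have inner: "(\<integral>\<omega>. ?F (p, \<omega>) \<partial>M) = (case p of (s, z) \<Rightarrow> ?K t x s z * ?K t y s z * (l\<^sup>2 * (\<sigma>\<^sup>2 + expectation (\<lambda>\<omega>. (u s z \<omega>)\<^sup>2))))"
      if p: "p \<in> space (slab t)" for p
    proof -
      obtain s z where sz: "p = (s, z)" "s \<ge> 0" using p by auto
      have XX: "?X t x s z \<omega> * ?X t y s z \<omega> = ?K t x s z * ?K t y s z * (l\<^sup>2 * (\<sigma>\<^sup>2 + (u s z \<omega>)\<^sup>2))" for \<omega>
        unfolding \<rho>[symmetric] by (simp add: power2_eq_square)
      show ?thesis
        using u2[OF sz(2), of z] unfolding sz prod.case XX by (simp add: prob_space)
    qed
    have eq: "integrable (slab t) (\<lambda>p. \<integral>\<omega>. ?F (p, \<omega>) \<partial>M) \<longleftrightarrow> integrable (slab t) (\<lambda>(s, z). ?K t x s z * ?K t y s z * (l\<^sup>2 * (\<sigma>\<^sup>2 + expectation (\<lambda>\<omega>. (u s z \<omega>)\<^sup>2))))"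
      using inner by (intro Bochner_Integration.integrable_cong) auto
    have eq': "(\<integral>p. \<integral>\<omega>. ?F (p, \<omega>) \<partial>M \<partial>slab t) = (\<integral>(s, z). ?K t x s z * ?K t y s z * (l\<^sup>2 * (\<sigma>\<^sup>2 + expectation (\<lambda>\<omega>. (u s z \<omega>)\<^sup>2))) \<partial>slab t)"
      using inner by (intro Bochner_Integration.integral_cong) auto
    show ?thesis
      using P.integrable_fst'[OF int] P.integral_fst'[OF int] unfolding eq eq' by simp
  qed
  then show "integrable (slab t) (\<lambda>(s, z). ?K t x s z * ?K t y s z * (l\<^sup>2 * (\<sigma>\<^sup>2 + expectation (\<lambda>\<omega>. (u s z \<omega>)\<^sup>2))))"
    if "t \<ge> 0" for t x y
    using that by blast
  show "has_bochner_integral M (\<lambda>\<omega>. u t x \<omega> * u t y \<omega>)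
      ((w + \<kappa> * w' * t)\<^sup>2 + (\<integral>(s, z). ?K t x s z * ?K t y s z * (l\<^sup>2 * (\<sigma>\<^sup>2 + expectation (\<lambda>\<omega>. (u s z \<omega>)\<^sup>2))) \<partial>slab t))"
    if t: "t \<ge> 0" for t x y
    using cov[OF t, of x y] cone[OF t, of x y] unfolding II[OF t] by simp
  have f: "expectation (\<lambda>\<omega>. (u t x \<omega>)\<^sup>2) = (w + \<kappa> * w' * t)\<^sup>2 + expectation (\<lambda>\<omega>. (I t x \<omega>)\<^sup>2)" if "t \<ge> 0" for t x
    using has_bochner_integral_integral_eq[OF cov[OF that, of x x]] by (simp add: power2_eq_square)
  have "continuous_on ({0..} \<times> UNIV) (\<lambda>p. expectation (\<lambda>\<omega>. (I (fst p) (snd p) \<omega>)\<^sup>2))"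
    unfolding continuous_on_def
  proof
    fix p :: "real \<times> real" assume p: "p \<in> {0..} \<times> UNIV"
    obtain t x where tx: "p = (t, x)" "t \<ge> 0" using p by auto
    show "((\<lambda>p. expectation (\<lambda>\<omega>. (I (fst p) (snd p) \<omega>)\<^sup>2)) \<longlongrightarrow> expectation (\<lambda>\<omega>. (I (fst p) (snd p) \<omega>)\<^sup>2)) (at p within {0..} \<times> UNIV)"
      unfolding tx fst_conv snd_conv
    proof (rule tendsto_integral_square[OF Im[OF tx(2)] _ I2[OF tx(2) tx(2)]])
      show "\<forall>\<^sub>F q in at (t, x) within {0..} \<times> UNIV. I (fst q) (snd q) \<in> borel_measurable M"
        unfolding eventually_at_filter by (rule always_eventually) (auto intro: Im)
      show "((\<lambda>q. \<integral>\<^sup>+\<omega>. ennreal ((I t x \<omega> - I (fst q) (snd q) \<omega>)\<^sup>2) \<partial>M) \<longlongrightarrow> 0) (at (t, x) within {0..} \<times> UNIV)"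
        using cI[OF tx(2), of x] by (simp add: L2_norm_sq_def case_prod_beta' power2_commute)
    qed
  qed
  then have "continuous_on ({0..} \<times> UNIV) (\<lambda>p. (w + \<kappa> * w' * fst p)\<^sup>2 + expectation (\<lambda>\<omega>. (I (fst p) (snd p) \<omega>)\<^sup>2))"
    by (intro continuous_intros)
  then show "continuous_on ({0..} \<times> UNIV) (\<lambda>(t, x). expectation (\<lambda>\<omega>. (u t x \<omega>)\<^sup>2))"
    by (rule continuous_on_eq) (auto simp: f)
qed

text \<open>A cone lies in a compact rectangle.\<close>

lemma continuous_on_bounded_on_cone:
  fixes f :: "real \<Rightarrow> real \<Rightarrow> real"
  assumes f: "continuous_on ({0..} \<times> UNIV) (\<lambda>(t, x). f t x)" and \<kappa>: "\<kappa> > 0"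
  shows "\<exists>B. \<forall>t x. 0 \<le> t \<longrightarrow> t \<le> t0 \<longrightarrow> \<bar>x - x0\<bar> \<le> \<kappa> * (t0 - t) \<longrightarrow> \<bar>f t x\<bar> \<le> B"
proof -
  let ?Q = "{0..t0} \<times> {x0 - \<kappa> * t0..x0 + \<kappa> * t0}"
  have "compact ?Q" by (intro compact_Times compact_Icc)
  moreover have "continuous_on ?Q (\<lambda>(t, x). f t x)"
    by (rule continuous_on_subset[OF f]) auto
  ultimately have "bounded ((\<lambda>(t, x). f t x) ` ?Q)"
    by (intro compact_imp_bounded compact_continuous_image)
  then obtain B where B: "\<And>p. p \<in> ?Q \<Longrightarrow> \<bar>case p of (t, x) \<Rightarrow> f t x\<bar> \<le> B"
    by (auto simp: bounded_iff)
  have "\<bar>f t x\<bar> \<le> B" if "0 \<le> t" "t \<le> t0" "\<bar>x - x0\<bar> \<le> \<kappa> * (t0 - t)" for t x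
  proof -
    have "\<kappa> * (t0 - t) \<le> \<kappa> * t0" using \<kappa> that by simp
    then have "(t, x) \<in> ?Q" using that by auto
    from B[OF this] show ?thesis by simp
  qed
  then show ?thesis by blast
qed

text \<open>The difference between the second moment and the closed form satisfies the homogeneous
  equation, to which uniqueness applies.\<close>

lemma (in space_time_white_noise) wave_solution_second_moment_eq:
  assumes \<kappa>: "\<kappa> > 0" and sol: "wave_solution M W \<kappa> \<rho> (\<lambda>_. w) (\<lambda>_. w') u"
    and \<rho>: "\<And>x. (\<rho> x)\<^sup>2 = l\<^sup>2 * (\<sigma>\<^sup>2 + x\<^sup>2)" and \<rho>c: "\<rho> \<in> borel_measurable borel"
    and l: "l \<noteq> 0" and t0: "t0 \<ge> 0"
  shows "expectation (\<lambda>\<omega>. (u t0 x0 \<omega>)\<^sup>2) = wave_second_moment \<kappa> l \<sigma> w w' t0"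
proof -
  let ?h = "wave_second_moment \<kappa> l \<sigma> w w'"
  note sm = wave_solution_second_moments[OF \<kappa> sol \<rho> \<rho>c]
  define f where "f t x = expectation (\<lambda>\<omega>. (u t x \<omega>)\<^sup>2)" for t x
  define d where "d t x = f t x - ?h t" for t x
  have "d t0 x0 = 0"
  proof (rule cone_inequality_unique[where d = d and C = "l\<^sup>2", OF \<kappa> _ _ _ t0])
    show "0 < l\<^sup>2" using l by simp
    have "continuous_on ({0..} \<times> UNIV) (\<lambda>(t, x). d t x)"
      using sm(4) unfolding d_def f_def wave_second_moment_def H_fun_def case_prod_beta'
      by (intro continuous_intros) auto
    from continuous_on_bounded_on_cone[OF this \<kappa>]
    show "\<exists>B. \<forall>t x. 0 \<le> t \<longrightarrow> t \<le> t1 \<longrightarrow> \<bar>x - x1\<bar> \<le> \<kappa> * (t1 - t) \<longrightarrow> \<bar>d t x\<bar> \<le> B" for t1 x1 .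
  next
    fix t x :: real assume t: "t \<ge> 0"
    let ?K = "\<lambda>s z. wave_kernel \<kappa> (t - s) (x - z)"
    have hf: "integrable (slab t) (\<lambda>(s, z). ?K s z * ?K s z * (l\<^sup>2 * (\<sigma>\<^sup>2 + f s z)))"
      "f t x = (w + \<kappa> * w' * t)\<^sup>2 + (\<integral>(s, z). ?K s z * ?K s z * (l\<^sup>2 * (\<sigma>\<^sup>2 + f s z)) \<partial>slab t)"
      using sm(3)[OF t, of x x] has_bochner_integral_integral_eq[OF sm(2)[OF t, of x x]]
      by (simp_all add: f_def power2_eq_square)
    have hh: "integrable (slab t) (\<lambda>(s, z). ?K s z * ?K s z * (l\<^sup>2 * (\<sigma>\<^sup>2 + ?h s)))"
      "?h t = (w + \<kappa> * w' * t)\<^sup>2 + (\<integral>(s, z). ?K s z * ?K s z * (l\<^sup>2 * (\<sigma>\<^sup>2 + ?h s)) \<partial>slab t)"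
      using wave_second_moment_cone[OF \<kappa> l t, of x x \<sigma> w w'] T_kappa_zero[OF \<kappa> t]
      by (simp_all add: has_bochner_integral_iff)
    have g: "(case p of (s, z) \<Rightarrow> ?K s z * ?K s z * (l\<^sup>2 * (\<sigma>\<^sup>2 + f s z))) -
        (case p of (s, z) \<Rightarrow> ?K s z * ?K s z * (l\<^sup>2 * (\<sigma>\<^sup>2 + ?h s))) =
        (case p of (s, z) \<Rightarrow> (?K s z)\<^sup>2 * (l\<^sup>2 * d s z))" for p
      by (cases p) (simp add: d_def power2_eq_square algebra_simps)
    have int: "integrable (slab t) (\<lambda>(s, z). (?K s z)\<^sup>2 * (l\<^sup>2 * d s z))"
      using Bochner_Integration.integrable_diff[OF hf(1) hh(1)] unfolding g .
    have "d t x = (\<integral>(s, z). (?K s z)\<^sup>2 * (l\<^sup>2 * d s z) \<partial>slab t)"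
      using Bochner_Integration.integral_diff[OF hf(1) hh(1)] hf(2) hh(2) unfolding g by (simp add: d_def)
    then have "ennreal \<bar>d t x\<bar> \<le> (\<integral>\<^sup>+p. norm (case p of (s, z) \<Rightarrow> (?K s z)\<^sup>2 * (l\<^sup>2 * d s z)) \<partial>slab t)"
      using integral_norm_bound_ennreal[OF int] by simp
    also have "\<dots> = (\<integral>\<^sup>+(s, z). ennreal ((?K s z)\<^sup>2 * (l\<^sup>2 * \<bar>d s z\<bar>)) \<partial>slab t)"
      by (rule nn_integral_cong) (auto simp: abs_mult)
    finally show "ennreal \<bar>d t x\<bar> \<le> (\<integral>\<^sup>+(s, z). ennreal ((?K s z)\<^sup>2 * (l\<^sup>2 * \<bar>d s z\<bar>)) \<partial>slab t)" .
  qed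
  then show ?thesis by (simp add: d_def f_def)
qed

lemma (in space_time_white_noise) wave_solution_covariance_eq:
  assumes \<kappa>: "\<kappa> > 0" and sol: "wave_solution M W \<kappa> \<rho> (\<lambda>_. w) (\<lambda>_. w') u"
    and \<rho>: "\<And>x. (\<rho> x)\<^sup>2 = l\<^sup>2 * (\<sigma>\<^sup>2 + x\<^sup>2)" and \<rho>c: "\<rho> \<in> borel_measurable borel"
    and l: "l \<noteq> 0" and t: "t \<ge> 0"
  defines "T \<equiv> \<lambda>z. T_kappa \<kappa> t z"
  shows "has_bochner_integral M (\<lambda>\<omega>. u t x \<omega> * u t y \<omega>)
    ((w + \<kappa> * w' * t)\<^sup>2 - (w + \<kappa> * w' * T (x - y))\<^sup>2 + wave_second_moment \<kappa> l \<sigma> w w' (T (x - y)))"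
proof -
  have "(\<integral>(s, z). wave_kernel \<kappa> (t - s) (x - z) * wave_kernel \<kappa> (t - s) (y - z) *
        (l\<^sup>2 * (\<sigma>\<^sup>2 + expectation (\<lambda>\<omega>. (u s z \<omega>)\<^sup>2))) \<partial>slab t) =
      (\<integral>(s, z). wave_kernel \<kappa> (t - s) (x - z) * wave_kernel \<kappa> (t - s) (y - z) *
        (l\<^sup>2 * (\<sigma>\<^sup>2 + wave_second_moment \<kappa> l \<sigma> w w' s)) \<partial>slab t)"
    by (rule Bochner_Integration.integral_cong) (auto simp: wave_solution_second_moment_eq[OF \<kappa> sol \<rho> \<rho>c l])
  also have "\<dots> = wave_second_moment \<kappa> l \<sigma> w w' (T (x - y)) - (w + \<kappa> * w' * T (x - y))\<^sup>2"
    unfolding T_def by (rule has_bochner_integral_integral_eq[OF wave_second_moment_cone[OF \<kappa> l t]])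
  finally have "has_bochner_integral M (\<lambda>\<omega>. u t x \<omega> * u t y \<omega>) ((w + \<kappa> * w' * t)\<^sup>2 +
      (wave_second_moment \<kappa> l \<sigma> w w' (T (x - y)) - (w + \<kappa> * w' * T (x - y))\<^sup>2))"
    using wave_solution_covariance[OF \<kappa> sol \<rho> \<rho>c t, of x y] by (simp only:)
  then show ?thesis by (simp add: add_diff_eq diff_add_eq)
qed

theorem corollary3p2:
  fixes M :: "'a measure" and W :: "(real \<times> real) set \<Rightarrow> 'a \<Rightarrow> real"
    and \<kappa> l \<sigma> w w' :: real and \<rho> :: "real \<Rightarrow> real" and u :: "real \<Rightarrow> real \<Rightarrow> 'a \<Rightarrow> real"
  assumes "space_time_white_noise M W"
    and "\<kappa> > 0"
    and "\<exists>L. L-lipschitz_on UNIV \<rho>"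
    and "\<forall>x. (\<rho> x)\<^sup>2 = l\<^sup>2 * (\<sigma>\<^sup>2 + x\<^sup>2)"
    and "l \<noteq> 0"
    and "\<sigma> \<ge> 0"
    and "wave_solution M W \<kappa> \<rho> (\<lambda>_. w) (\<lambda>_. w') u"
  shows
    "(\<forall>t\<ge>0. \<forall>x.
        L2_norm_sq M (u t x) < \<infinity> \<and>
        enn2real (L2_norm_sq M (u t x)) =
          w\<^sup>2 + (w\<^sup>2 + \<sigma>\<^sup>2 + 4 * \<kappa> * w'\<^sup>2 / l\<^sup>2) * H_fun \<kappa> l t
            + 2 * sqrt (2 * \<kappa>) * w * w' / \<bar>l\<bar> * sinh (sqrt \<kappa> * \<bar>l\<bar> * t / sqrt 2) \<and>
        (\<sigma> = 0 \<and> w' = 0 \<longrightarrow>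
          enn2real (L2_norm_sq M (u t x)) = w\<^sup>2 * (H_fun \<kappa> l t + 1)) \<and>
        (\<sigma> = 0 \<and> w = 0 \<longrightarrow>
          enn2real (L2_norm_sq M (u t x)) = 4 * \<kappa> * w'\<^sup>2 / l\<^sup>2 * H_fun \<kappa> l t)) \<and>
     (\<forall>t\<ge>0. \<forall>x y. let T = T_kappa \<kappa> t (x - y) in
        integrable M (\<lambda>\<omega>. u t x \<omega> * u t y \<omega>) \<and>
        (\<integral>\<omega>. u t x \<omega> * u t y \<omega> \<partial>M) =
          w\<^sup>2 + \<kappa> * w' * (t - T) * (2 * w + \<kappa> * w' * (t + T))
            + (w\<^sup>2 + \<sigma>\<^sup>2 + 4 * \<kappa> * w'\<^sup>2 / l\<^sup>2) * H_fun \<kappa> l T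
            + 2 * sqrt (2 * \<kappa>) * w * w' / \<bar>l\<bar> * sinh (sqrt \<kappa> * \<bar>l\<bar> / sqrt 2 * T) \<and>
        (\<sigma> = 0 \<and> w' = 0 \<longrightarrow>
          (\<integral>\<omega>. u t x \<omega> * u t y \<omega> \<partial>M) = w\<^sup>2 * (H_fun \<kappa> l T + 1)) \<and>
        (\<sigma> = 0 \<and> w = 0 \<longrightarrow>
          (\<integral>\<omega>. u t x \<omega> * u t y \<omega> \<partial>M) =
            4 * \<kappa> * w'\<^sup>2 / l\<^sup>2 * H_fun \<kappa> l T + \<kappa>\<^sup>2 * w'\<^sup>2 * (t\<^sup>2 - T\<^sup>2)))"
proof -
  interpret space_time_white_noise M W by fact
  note \<kappa> = assms(2) and l = assms(5) and sol = assms(7)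
  have \<rho>: "(\<rho> x)\<^sup>2 = l\<^sup>2 * (\<sigma>\<^sup>2 + x\<^sup>2)" for x using assms(4) by blast
  have \<rho>c: "\<rho> \<in> borel_measurable borel"
    using assms(3) by (auto intro: borel_measurable_continuous_onI lipschitz_on_continuous_on)
  have norm: "L2_norm_sq M (u t x) = ennreal (wave_second_moment \<kappa> l \<sigma> w w' t)"
    and nonneg: "wave_second_moment \<kappa> l \<sigma> w w' t \<ge> 0" if t: "t \<ge> 0" for t x
  proof -
    note eq = wave_solution_second_moment_eq[OF \<kappa> sol \<rho> \<rho>c l t, symmetric]
    show "L2_norm_sq M (u t x) = ennreal (wave_second_moment \<kappa> l \<sigma> w w' t)"
      unfolding L2_norm_sq_def eq[of x]
      using wave_solution_L2[OF \<kappa> sol \<rho> \<rho>c t, of x] by (intro nn_integral_eq_integral) auto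
    show "wave_second_moment \<kappa> l \<sigma> w w' t \<ge> 0" unfolding eq[of x] by simp
  qed
  have part1: "L2_norm_sq M (u t x) < \<infinity> \<and>
      enn2real (L2_norm_sq M (u t x)) = wave_second_moment \<kappa> l \<sigma> w w' t" if "t \<ge> 0" for t x
    using norm[OF that, of x] nonneg[OF that] by simp
  have part2: "integrable M (\<lambda>\<omega>. u t x \<omega> * u t y \<omega>) \<and>
      (\<integral>\<omega>. u t x \<omega> * u t y \<omega> \<partial>M) = \<kappa> * w' * (t - T) * (2 * w + \<kappa> * w' * (t + T)) + wave_second_moment \<kappa> l \<sigma> w w' T"
    if "t \<ge> 0" "T = T_kappa \<kappa> t (x - y)" for t x y T
  proof -
    have "(w + \<kappa> * w' * t)\<^sup>2 - (w + \<kappa> * w' * T)\<^sup>2 = \<kappa> * w' * (t - T) * (2 * w + \<kappa> * w' * (t + T))"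
      by (simp add: power2_eq_square algebra_simps)
    then show ?thesis
      using wave_solution_covariance_eq[OF \<kappa> sol \<rho> \<rho>c l that(1), of x y] that(2)
      by (simp add: has_bochner_integral_iff)
  qed
  have arg: "sqrt \<kappa> * \<bar>l\<bar> / sqrt 2 * s = sqrt \<kappa> * \<bar>l\<bar> * s / sqrt 2" for s by simp
  have sq: "\<kappa> * w' * (t - T) * (\<kappa> * w' * (t + T)) = \<kappa>\<^sup>2 * w'\<^sup>2 * (t\<^sup>2 - T\<^sup>2)" for t T
    by (simp add: power2_eq_square algebra_simps)
  show ?thesis
    unfolding Let_def arg
  proof (intro conjI allI impI)
    fix t x :: real assume t: "t \<ge> 0"
    show "L2_norm_sq M (u t x) < \<infinity>" using part1[OF t] by blast
    show "enn2real (L2_norm_sq M (u t x)) =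
          w\<^sup>2 + (w\<^sup>2 + \<sigma>\<^sup>2 + 4 * \<kappa> * w'\<^sup>2 / l\<^sup>2) * H_fun \<kappa> l t
            + 2 * sqrt (2 * \<kappa>) * w * w' / \<bar>l\<bar> * sinh (sqrt \<kappa> * \<bar>l\<bar> * t / sqrt 2)"
      using part1[OF t] by (simp only: wave_second_moment_def)
    show "enn2real (L2_norm_sq M (u t x)) = w\<^sup>2 * (H_fun \<kappa> l t + 1)" if "\<sigma> = 0 \<and> w' = 0"
      using part1[OF t, of x] that by (simp add: wave_second_moment_def algebra_simps)
    show "enn2real (L2_norm_sq M (u t x)) = 4 * \<kappa> * w'\<^sup>2 / l\<^sup>2 * H_fun \<kappa> l t" if "\<sigma> = 0 \<and> w = 0"
      using part1[OF t, of x] that by (simp add: wave_second_moment_def)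
  next
    fix t x y :: real assume t: "t \<ge> 0"
    let ?T = "T_kappa \<kappa> t (x - y)"
    note p2 = part2[OF t refl, of x y]
    show "integrable M (\<lambda>\<omega>. u t x \<omega> * u t y \<omega>)" using p2 by blast
    show "(\<integral>\<omega>. u t x \<omega> * u t y \<omega> \<partial>M) =
          w\<^sup>2 + \<kappa> * w' * (t - ?T) * (2 * w + \<kappa> * w' * (t + ?T))
            + (w\<^sup>2 + \<sigma>\<^sup>2 + 4 * \<kappa> * w'\<^sup>2 / l\<^sup>2) * H_fun \<kappa> l ?T
            + 2 * sqrt (2 * \<kappa>) * w * w' / \<bar>l\<bar> * sinh (sqrt \<kappa> * \<bar>l\<bar> * ?T / sqrt 2)"
      using p2 by (simp add: wave_second_moment_def)
    show "(\<integral>\<omega>. u t x \<omega> * u t y \<omega> \<partial>M) = w\<^sup>2 * (H_fun \<kappa> l ?T + 1)" if "\<sigma> = 0 \<and> w' = 0"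
      using p2 that by (simp add: wave_second_moment_def algebra_simps)
    show "(\<integral>\<omega>. u t x \<omega> * u t y \<omega> \<partial>M) =
        4 * \<kappa> * w'\<^sup>2 / l\<^sup>2 * H_fun \<kappa> l ?T + \<kappa>\<^sup>2 * w'\<^sup>2 * (t\<^sup>2 - ?T\<^sup>2)" if "\<sigma> = 0 \<and> w = 0"
      using p2 that sq[of t ?T] by (simp add: wave_second_moment_def)
  qed
qed

end
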